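(* Let $G$ be a countably infinite discrete group, let $G\curvearrowright X$ be a continuous action on a compact metrizable space $X$ with compatible metric $\rho$, preserving a Borel probability measure $\mu$, and let $\pi:(X,\mu,G)\to(Y,\nu,G)$ be a relatively mixing factor map which is not an isomorphism. Write $\mu=\int_Y\mu_y\,d\nu(y)$ for the disintegration of $\mu$ over $\pi$ and put $Y_{\mathrm{na}}:=\{y\in Y:\mu_y\text{ is nonatomic}\}$. Then $\nu(Y_{\mathrm{na}})>0$, and the following statements hold. (i) For every injective sequence $\mathbf{s}=(s_i)_{i\geq1}\subseteq G$ and for $\nu$-a.e. $y\in Y_{\mathrm{na}}$, there are $\delta_{y,\mathbf{s}}>0$ and a dense Mycielski set $M_{y,\mathbf{s}}\subseteq\operatorname{supp}(\mu_y)$ such that all distinct points $x,x'\in M_{y,\mathbf{s}}$ satisfy \[ \liminf_{i\to\infty}\rho(s_i x,s_i x')=0,\qquad \limsup_{i\to\infty}\rho(s_i x,s_i x')>\delta_{y,\mathbf{s}} . \] (ii) There exists a constant $\delta_*>0$, depending only on the extension $\pi$ and on $\rho$, such that for every injective sequence $\mathbf{s}=(s_i)_{i\geq1}\subseteq G$ there exists a measurable set $Y^*_{\mathbf{s}}\subseteq Y_{\mathrm{na}}$ with $\nu(Y^*_{\mathbf{s}})>0$ and with the following property: for every $y\in Y^*_{\mathbf{s}}$ there is a dense Mycielski set $M_{y,\mathbf{s}}\subseteq\operatorname{supp}(\mu_y)$ such that all distinct $x,x'\in M_{y,\mathbf{s}}$ satisfy \[ \liminf_{i\to\infty}\rho(s_i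 x,s_i x')=0,\qquad \limsup_{i\to\infty}\rho(s_i x,s_i x')>\delta_* . \]
   Context: A p.m.p. $G$-system is a standard probability space with a measurable, measure-preserving action of $G$. $(Y,\nu,G)$ is a p.m.p. $G$-system. A factor map $\pi:(X,\mu,G)\to(Y,\nu,G)$ is a measurable map with $\pi_*\mu=\nu$ and, for every $g\in G$, $\pi(gx)=g\pi(x)$ for $\mu$-a.e. $x$. It is an isomorphism if there are invariant conull Borel sets $X_0\subseteq X$, $Y_0\subseteq Y$ with $\pi(X_0)=Y_0$ such that $\pi|_{X_0}:X_0\to Y_0$ is a bimeasurable $G$-equivariant bijection. All measure-theoretic objects (including disintegrations) are understood modulo null sets. With the disintegration $\mu=\int_Y\mu_y\,d\nu(y)$ over $\pi$, put $\mathbb E^X_Yf(y)=\int_X f\,d\mu_y$ for $f\in L^1(X,\mu)$, and $U_gf(x)=f(g^{-1}x)$. The notation $g\to\infty$ means that $g$ eventually leaves every finite subset of $G$. The factor map $\pi$ is relatively mixing if for all $f,h\in L^\infty(X,\mu)$ with $\mathbb E^X_Yf=\mathbb E^X_Yh=0$ one has $\|\mathbb E^X_Y(U_gf\,h)\|_{L^2(Y,\nu)}\to0$ as $g\to\infty$. A Mycielski set is a subset of a metrizable space that can be written as a countable union of Cantor sets (subsets homeomorphic to the standard Cantor set); "dense Mycielski set $M\subseteq\operatorname{supp}(\mu_y)$" means that $M$ is dense in $\operatorname{supp}(\mu_y)$. $\operatorname{supp}(\mu_y)$ is the topological support of $\mu_y$ in $X$. *)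

theory Defs
  imports "HOL-Probability.Probability" "HOL-Algebra.Group_Action"
begin

section \<open>Cantor and Mycielski sets\<close>

text \<open>The middle-thirds set: the reals in \<open>[0,1]\<close> with a ternary expansion using only the
  digits 0 and 2.\<close>

definition cantor_set :: "real set" where
  "cantor_set = range (\<lambda>a :: nat \<Rightarrow> bool. \<Sum>n. 2 * of_bool (a n) / 3 ^ Suc n)"

definition mycielski_set :: "'a :: metric_space set \<Rightarrow> bool" where
  "mycielski_set M \<longleftrightarrow>
     (\<exists>\<C>. countable \<C> \<and> (\<forall>C\<in>\<C>. C homeomorphic cantor_set) \<and> M = \<Union>\<C>)"

definition dense_mycielski_subset :: "'a :: metric_space set \<Rightarrow> 'a set \<Rightarrow> bool" where
  "dense_mycielski_subset M S \<longleftrightarrow> mycielski_set M \<and> M \<subseteq> S \<and> S \<subseteq> closure M"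


section \<open>Measures\<close>

definition measure_supp :: "'a :: topological_space measure \<Rightarrow> 'a set" where
  "measure_supp M = {x. \<forall>U. open U \<longrightarrow> x \<in> U \<longrightarrow> emeasure M U > 0}"

definition nonatomic :: "'a measure \<Rightarrow> bool" where
  "nonatomic M \<longleftrightarrow>
     (\<forall>A\<in>sets M. emeasure M A > 0 \<longrightarrow>
        (\<exists>B\<in>sets M. B \<subseteq> A \<and> 0 < emeasure M B \<and> emeasure M B < emeasure M A))"

definition standard_borel :: "'a measure \<Rightarrow> bool" where
  "standard_borel M \<longleftrightarrow>
     (\<exists>T. completely_metrizable_space T \<and> second_countable T \<and> topspace T = space M \<and>
          sets M = sigma_sets (space M) {U. openin T U})"

definition standard_prob_space :: "'a measure \<Rightarrow> bool" where
  "standard_prob_space M \<longleftrightarrow> standard_borel M \<and> prob_space M"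


section \<open>Measure-preserving actions and factor maps\<close>

text \<open>\<^const>\<open>group_action\<close> requires the maps \<open>\<phi> g\<close> to be \<^const>\<open>undefined\<close> outside
  \<open>space M\<close>; this is only a normalization.\<close>

definition mp_action :: "('g, 'r) monoid_scheme \<Rightarrow> 'a measure \<Rightarrow> ('g \<Rightarrow> 'a \<Rightarrow> 'a) \<Rightarrow> bool" where
  "mp_action G M \<phi> \<longleftrightarrow>
     group_action G (space M) \<phi> \<and>
     (\<forall>g\<in>carrier G. \<phi> g \<in> measurable M M \<and> distr M M (\<phi> g) = M)"

definition factor_map ::
  "('g, 'r) monoid_scheme \<Rightarrow> 'a measure \<Rightarrow> ('g \<Rightarrow> 'a \<Rightarrow> 'a) \<Rightarrow> 'b measure \<Rightarrow> ('g \<Rightarrow> 'b \<Rightarrow> 'b) \<Rightarrow>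
     ('a \<Rightarrow> 'b) \<Rightarrow> bool" where
  "factor_map G M \<phi> N \<psi> \<pi> \<longleftrightarrow>
     \<pi> \<in> measurable M N \<and> distr M N \<pi> = N \<and>
     (\<forall>g\<in>carrier G. AE x in M. \<pi> (\<phi> g x) = \<psi> g (\<pi> x))"

definition system_isomorphism ::
  "('g, 'r) monoid_scheme \<Rightarrow> 'a measure \<Rightarrow> ('g \<Rightarrow> 'a \<Rightarrow> 'a) \<Rightarrow> 'b measure \<Rightarrow> ('g \<Rightarrow> 'b \<Rightarrow> 'b) \<Rightarrow>
     ('a \<Rightarrow> 'b) \<Rightarrow> bool" where
  "system_isomorphism G M \<phi> N \<psi> \<pi> \<longleftrightarrow>
     (\<exists>X\<^sub>0\<in>sets M. \<exists>Y\<^sub>0\<in>sets N.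
        (AE x in M. x \<in> X\<^sub>0) \<and> (AE y in N. y \<in> Y\<^sub>0) \<and>
        (\<forall>g\<in>carrier G. \<phi> g ` X\<^sub>0 = X\<^sub>0 \<and> \<psi> g ` Y\<^sub>0 = Y\<^sub>0) \<and>
        bij_betw \<pi> X\<^sub>0 Y\<^sub>0 \<and>
        \<pi> \<in> measurable (restrict_space M X\<^sub>0) (restrict_space N Y\<^sub>0) \<and>
        the_inv_into X\<^sub>0 \<pi> \<in> measurable (restrict_space N Y\<^sub>0) (restrict_space M X\<^sub>0) \<and>
        (\<forall>g\<in>carrier G. \<forall>x\<in>X\<^sub>0. \<pi> (\<phi> g x) = \<psi> g (\<pi> x)))"


section \<open>Disintegrations and relative mixing\<close>

text \<open>The second conjunct is \<open>M A = (\<integral>\<^sup>+ y. K y A \<partial>N)\<close>, the third says that \<open>K y\<close> is concentrated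
  on the fibre over \<open>y\<close>.\<close>

definition disintegration ::
  "'a measure \<Rightarrow> 'b measure \<Rightarrow> ('a \<Rightarrow> 'b) \<Rightarrow> ('b \<Rightarrow> 'a measure) \<Rightarrow> bool" where
  "disintegration M N \<pi> K \<longleftrightarrow>
     K \<in> measurable N (prob_algebra M) \<and>
     (\<forall>A\<in>sets M. emeasure M A = (\<integral>\<^sup>+ y. emeasure (K y) A \<partial>N)) \<and>
     (AE y in N. AE x in K y. \<pi> x = y)"

definition nonatomic_fibres :: "'b measure \<Rightarrow> ('b \<Rightarrow> 'a measure) \<Rightarrow> 'b set" where
  "nonatomic_fibres N K = {y\<in>space N. nonatomic (K y)}"

definition Linfty :: "'a measure \<Rightarrow> ('a \<Rightarrow> real) set" where
  "Linfty M = {f \<in> borel_measurable M. \<exists>C. AE x in M. \<bar>f x\<bar> \<le> C}"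

definition fibre_expectation :: "('b \<Rightarrow> 'a measure) \<Rightarrow> ('a \<Rightarrow> real) \<Rightarrow> 'b \<Rightarrow> real" where
  "fibre_expectation K f y = (\<integral>x. f x \<partial>K y)"

definition koopman ::
  "('g, 'r) monoid_scheme \<Rightarrow> ('g \<Rightarrow> 'a \<Rightarrow> 'a) \<Rightarrow> 'g \<Rightarrow> ('a \<Rightarrow> real) \<Rightarrow> 'a \<Rightarrow> real" where
  "koopman G \<phi> g f x = f (\<phi> (inv\<^bsub>G\<^esub> g) x)"

definition L2_norm_on :: "'b measure \<Rightarrow> ('b \<Rightarrow> real) \<Rightarrow> real" where
  "L2_norm_on N u = sqrt (\<integral>y. (u y)\<^sup>2 \<partial>N)"

text \<open>The filter of \<open>g \<rightarrow> \<infinity>\<close>: a property holds eventually iff it holds on \<open>carrier G\<close> outside a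
  finite set.\<close>

definition group_at_infinity :: "('g, 'r) monoid_scheme \<Rightarrow> 'g filter" where
  "group_at_infinity G = inf cofinite (principal (carrier G))"

definition relatively_mixing ::
  "('g, 'r) monoid_scheme \<Rightarrow> 'a measure \<Rightarrow> ('g \<Rightarrow> 'a \<Rightarrow> 'a) \<Rightarrow> 'b measure \<Rightarrow>
     ('b \<Rightarrow> 'a measure) \<Rightarrow> bool" where
  "relatively_mixing G M \<phi> N K \<longleftrightarrow>
     (\<forall>f\<in>Linfty M. \<forall>h\<in>Linfty M.
        (AE y in N. fibre_expectation K f y = 0) \<longrightarrow>
        (AE y in N. fibre_expectation K h y = 0) \<longrightarrow>
        ((\<lambda>g. L2_norm_on N (fibre_expectation K (\<lambda>x. koopman G \<phi> g f x * h x))) \<longlongrightarrow> 0)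
          (group_at_infinity G))"


section \<open>Scrambled sets along a sequence\<close>

definition scrambled_along ::
  "('g \<Rightarrow> 'a \<Rightarrow> 'a :: metric_space) \<Rightarrow> (nat \<Rightarrow> 'g) \<Rightarrow> real \<Rightarrow> 'a set \<Rightarrow> bool" where
  "scrambled_along \<phi> s \<delta> M \<longleftrightarrow>
     (\<forall>x\<in>M. \<forall>x'\<in>M. x \<noteq> x' \<longrightarrow>
        liminf (\<lambda>i. ereal (dist (\<phi> (s i) x) (\<phi> (s i) x'))) = 0 \<and>
        limsup (\<lambda>i. ereal (dist (\<phi> (s i) x) (\<phi> (s i) x'))) > ereal \<delta>)"

end

theory Submission
  imports Defs "HOL-Library.Diagonal_Subsequence"
begin

text \<open>
  Write \<open>K y\<close> for the fibre measure over \<open>y\<close>.  Tested on centred indicator functions, relative mixing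
  says that for \<open>g \<rightarrow> \<infinity>\<close> the events \<open>\<alpha> g -` A\<close> and \<open>B\<close> become independent under \<open>K y\<close>, in \<open>L\<^sup>1\<close> with
  respect to \<open>y\<close> (\<open>decorrelation_tendsto_0\<close>).  Everything follows from this, applied to the cells of a
  refining sequence of finite Borel partitions.

  \<^item> \<^emph>\<open>Fibre measures are nonatomic or Dirac\<close> (\<open>diagonal_mass_zero_one\<close>).  The mass \<open>a y\<close> of the diagonal
    under the square of \<open>K y\<close> is the sum of the squares of its point masses.  The diagonal is covered
    by the squares over the common refinement of a partition and its translate.  As these partitions
    become independent, the integral of \<open>a\<close> is at most that of \<open>a\<^sup>2\<close>, so \<open>a\<close> is 0 or 1.  If it were 1 almost
    everywhere, the point carrying \<open>K y\<close> would define an inverse of \<open>\<pi>\<close> up to null sets, and \<open>\<pi>\<close> would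
    be an isomorphism (\<open>Dirac_fibres_imp_isomorphism\<close>).

  \<^item> \<^emph>\<open>Pairs recur.\<close>  Along a subsequence of a given sequence \<open>s\<close>, the preimages of cells are, for almost
    every \<open>y\<close>, mixing sequences of events in the sense of Renyi with respect to \<open>K y\<close>, and so are the
    preimages of finite unions of cell rectangles with respect to its square.  Almost every point
    lies in infinitely many members of such a sequence as soon as infinitely many of them have
    probability bounded below (\<open>mixing_events_infinitely_often\<close>).

  \<^item> \<^emph>\<open>Lower bounds.\<close>  For pairs in a common cell the bound is the inverse of the number of cells, by
    Cauchy--Schwarz.  For pairs in far apart cells the bound holds at time \<open>i\<close> if \<open>\<beta> (s i) y\<close> lies in the
    set of base points whose fibre measure is spread out by a fixed amount.  As \<open>\<beta>\<close> preserves \<open>\<nu>\<close>, the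
    points \<open>y\<close> for which this happens infinitely often form a set at least as large, whatever \<open>s\<close> is
    (\<open>measure_spread_base_le\<close>).  One fixed amount gives the uniform constant on a set of positive
    measure; letting the amount tend to 0 reaches almost every \<open>y\<close> with nonatomic fibre measure.

  \<^item> \<^emph>\<open>From almost every pair to a dense set.\<close>  A set of full measure in the square of \<open>K y\<close> is dense in
    the square of its support, and the recurrence conditions are countable intersections of open
    conditions; so Mycielski's theorem (\<open>mycielski\<close>) yields the scrambled set.
\<close>

section \<open>Mycielski's theorem\<close>

text \<open>At the first index where two digit sequences differ, the digits differ by \<open>2 / 3 ^ Suc k\<close>, while the
  remaining digits contribute at most \<open>1 / 3 ^ Suc k\<close>.\<close>

lemma cantor_set_digit_sums_inj:
  "inj (\<lambda>a :: nat \<Rightarrow> bool. \<Sum>n. 2 * of_bool (a n) / 3 ^ Suc n :: real)"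
proof (rule injI)
  fix a b :: "nat \<Rightarrow> bool"
  let ?d = "\<lambda>a n. 2 * of_bool (a n) / 3 ^ Suc n :: real"
  assume eq: "(\<Sum>n. ?d a n) = (\<Sum>n. ?d b n)"
  have geo: "(\<lambda>n. 2 / 3 ^ Suc n :: real) sums 1"
    using sums_mult[OF geometric_sums[of "1/3 :: real"], of "2/3"] by (simp add: power_one_over field_simps)
  have tail: "(\<Sum>n. 2 / 3 ^ Suc (n + k) :: real) = 1 / 3 ^ k" for k
  proof -
    have "(\<lambda>n. (2 / 3 ^ Suc n) / 3 ^ k :: real) sums (1 / 3 ^ k)"
      by (rule sums_divide[OF geo])
    then show ?thesis by (simp add: sums_iff power_add mult_ac)
  qed
  have sum_tail: "summable (\<lambda>n. 2 / 3 ^ Suc (n + k) :: real)" for k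
    using summable_ignore_initial_segment[OF sums_summable[OF geo], of k] by simp
  have d: "summable (?d a)" for a
    by (rule summable_comparison_test'[OF sums_summable[OF geo], of 0]) (auto simp: of_bool_def)
  show "a = b"
  proof (rule ccontr)
    assume "a \<noteq> b"
    then have ex: "\<exists>n. a n \<noteq> b n" by auto
    define k where "k = (LEAST n. a n \<noteq> b n)"
    have k: "a k \<noteq> b k" unfolding k_def using LeastI_ex[OF ex] .
    have less: "a i = b i" if "i < k" for i
      using not_less_Least that unfolding k_def by blast
    have split: "(\<Sum>n. ?d c n) = (\<Sum>n<k. ?d c n) + ?d c k + (\<Sum>n. ?d c (n + Suc k))" for c
      using suminf_split_initial_segment[OF d, of c "Suc k"] by simp
    have tail_le: "(\<Sum>n. ?d c (n + Suc k)) \<le> 1 / 3 ^ Suc k" for c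
      unfolding tail[of "Suc k", symmetric]
      by (rule suminf_le[OF _ summable_ignore_initial_segment[OF d] sum_tail]) (auto simp: of_bool_def)
    have tail_ge: "0 \<le> (\<Sum>n. ?d c (n + Suc k))" for c
      by (rule suminf_nonneg[OF summable_ignore_initial_segment[OF d]]) auto
    have *: "?d a k + (\<Sum>n. ?d a (n + Suc k)) = ?d b k + (\<Sum>n. ?d b (n + Suc k))"
      using eq less unfolding split by (simp cong: sum.cong_simp)
    have p: "0 < 1 / (3::real) ^ Suc k" by simp
    consider "a k" "\<not> b k" | "b k" "\<not> a k" using k by blast
    then show False
    proof cases
      case 1
      then have "?d a k = 2 * (1 / 3 ^ Suc k)" "?d b k = 0" by simp_all
      then show False using * tail_le[of b] tail_ge[of a] p by linarith
    next
      case 2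
      then have "?d b k = 2 * (1 / 3 ^ Suc k)" "?d a k = 0" by simp_all
      then show False using * tail_le[of a] tail_ge[of b] p by linarith
    qed
  qed
qed

lemma compact_UNIV_bool_sequences: "compact (UNIV :: (nat \<Rightarrow> bool) set)"
proof -
  have "compact (UNIV :: bool set)" by (simp add: finite_imp_compact)
  then have "compactin (product_topology (\<lambda>i::nat. euclidean :: bool topology) UNIV) (PiE UNIV (\<lambda>_. UNIV))"
    unfolding compactin_PiE by (auto simp: compactin_euclidean_iff)
  then show ?thesis
    unfolding euclidean_product_topology PiE_UNIV_domain by (simp add: compactin_euclidean_iff)
qed

text \<open>Continuity on the Cantor space is uniform control by finite prefixes, because the cylinder
  sets are open.\<close>

lemma continuous_on_bool_sequences:
  fixes e :: "(nat \<Rightarrow> bool) \<Rightarrow> 'a :: metric_space"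
  assumes "\<And>\<epsilon>. 0 < \<epsilon> \<Longrightarrow> \<exists>n. \<forall>a b. (\<forall>i<n. a i = b i) \<longrightarrow> dist (e a) (e b) < \<epsilon>"
  shows "continuous_on UNIV e"
  unfolding continuous_on_def tendsto_iff
proof (intro ballI allI impI)
  fix a :: "nat \<Rightarrow> bool" and \<epsilon> :: real assume "0 < \<epsilon>"
  then obtain n where n: "\<And>a b. (\<forall>i<n. a i = b i) \<Longrightarrow> dist (e a) (e b) < \<epsilon>" using assms by blast
  let ?C = "\<Inter>i\<in>{..<n}. (\<lambda>b. b i) -` {a i} :: (nat \<Rightarrow> bool) set"
  have "open ?C"
    by (intro open_INT finite_lessThan ballI open_vimage) (auto intro: Topological_Spaces.open_discrete)
  moreover have "a \<in> ?C" by simp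
  moreover have "dist (e b) (e a) < \<epsilon>" if "b \<in> ?C" for b
    using that by (intro n) auto
  ultimately show "\<forall>\<^sub>F b in at a within UNIV. dist (e b) (e a) < \<epsilon>"
    unfolding eventually_at_topological by blast
qed

text \<open>Both \<open>range e\<close> and \<open>cantor_set\<close> are injective continuous images of the compact space of bool
  sequences, and such maps into Hausdorff spaces are homeomorphisms onto their images.\<close>

lemma range_homeomorphic_cantor_set:
  fixes e :: "(nat \<Rightarrow> bool) \<Rightarrow> 'a :: metric_space"
  assumes "continuous_on UNIV e" and "inj e"
  shows "range e homeomorphic cantor_set"
proof -
  let ?c = "\<lambda>a :: nat \<Rightarrow> bool. \<Sum>n. 2 * of_bool (a n) / 3 ^ Suc n :: real"
  have "continuous_on UNIV ?c"
  proof (rule continuous_on_bool_sequences)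
    fix \<epsilon> :: real assume "0 < \<epsilon>"
    have geo: "summable (\<lambda>n. 2 / 3 ^ Suc n :: real)"
      using summable_mult[OF summable_geometric[of "1/3 :: real"], of "2/3"] by (simp add: power_one_over field_simps)
    from suminf_exist_split[OF \<open>0 < \<epsilon>\<close> geo] obtain n where n: "norm (\<Sum>i. 2 / 3 ^ Suc (i + n) :: real) < \<epsilon>"
      by auto
    have gn: "summable (\<lambda>i. 2 / 3 ^ Suc (i + n) :: real)"
      using summable_ignore_initial_segment[OF geo, of n] .
    have d: "summable (\<lambda>n. 2 * of_bool (a n) / 3 ^ Suc n :: real)" for a
      by (rule summable_comparison_test'[OF geo, of 0]) (auto simp: of_bool_def)
    have "dist (?c a) (?c b) < \<epsilon>" if "\<forall>i<n. a i = b i" for a b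
    proof -
      let ?f = "\<lambda>i. (2 * of_bool (a i) / 3 ^ Suc i - 2 * of_bool (b i) / 3 ^ Suc i) :: real"
      have f: "summable ?f" by (rule summable_diff[OF d d])
      have "?c a - ?c b = (\<Sum>i. ?f i)" by (rule suminf_diff[OF d d])
      also have "\<dots> = (\<Sum>i. ?f (i + n))"
        unfolding suminf_split_initial_segment[OF f, of n] using that by (simp cong: sum.cong_simp)
      finally have "norm (?c a - ?c b) = norm (\<Sum>i. ?f (i + n))" by simp
      also have "\<dots> \<le> (\<Sum>i. 2 / 3 ^ Suc (i + n))"
        by (rule norm_suminf_le[OF _ gn]) (auto simp: of_bool_def)
      also have "\<dots> < \<epsilon>" using n by (simp add: abs_less_iff)
      finally show ?thesis by (simp add: dist_norm)
    qed
    then show "\<exists>n. \<forall>a b. (\<forall>i<n. a i = b i) \<longrightarrow> dist (?c a) (?c b) < \<epsilon>" by blast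
  qed
  from homeomorphic_compact[OF compact_UNIV_bool_sequences this _ cantor_set_digit_sums_inj]
  have "(UNIV :: (nat \<Rightarrow> bool) set) homeomorphic cantor_set" by (simp add: cantor_set_def)
  moreover have "(UNIV :: (nat \<Rightarrow> bool) set) homeomorphic range e"
    by (rule homeomorphic_compact[OF compact_UNIV_bool_sequences assms(1) refl assms(2)])
  ultimately show ?thesis using homeomorphic_sym homeomorphic_trans by blast
qed

text \<open>The finite step in the construction of independent Cantor sets.  The constraints in \<open>T\<close> are treated
  one after the other: density gives a pair of points of \<open>Z\<close> satisfying the constraint, openness a
  rectangle around it, and shrinking the two open sets to that rectangle does not destroy the
  constraints treated before.\<close>

lemma open_rectangles_refinement:
  fixes Z :: "'a :: metric_space set" and T :: "('l \<times> 'l \<times> ('a \<times> 'a) set) set"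
  assumes "finite T"
    and V: "\<And>l. open (V l) \<and> V l \<inter> Z \<noteq> {}"
    and T: "\<And>l l' G. (l, l', G) \<in> T \<Longrightarrow> l \<noteq> l' \<and> open G \<and>
       (\<forall>A B. open A \<and> open B \<and> A \<inter> Z \<noteq> {} \<and> B \<inter> Z \<noteq> {} \<longrightarrow> (\<exists>x\<in>A \<inter> Z. \<exists>y\<in>B \<inter> Z. (x, y) \<in> G))"
  shows "\<exists>U. \<forall>l. open (U l) \<and> U l \<inter> Z \<noteq> {} \<and> U l \<subseteq> V l \<and>
           (\<forall>l' G. (l, l', G) \<in> T \<longrightarrow> U l \<times> U l' \<subseteq> G)"
  using assms(1) T
proof (induction T rule: finite_induct)
  case empty
  show ?case using V by (intro exI[of _ V]) simp
next
  case (insert t T)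
  obtain l0 l1 G where t: "t = (l0, l1, G)" by (cases t)
  have "\<exists>U. \<forall>l. open (U l) \<and> U l \<inter> Z \<noteq> {} \<and> U l \<subseteq> V l \<and>
           (\<forall>l' G. (l, l', G) \<in> T \<longrightarrow> U l \<times> U l' \<subseteq> G)"
    by (rule insert.IH) (rule insert.prems, simp)
  then obtain U where "\<forall>l. open (U l) \<and> U l \<inter> Z \<noteq> {} \<and> U l \<subseteq> V l \<and>
           (\<forall>l' G. (l, l', G) \<in> T \<longrightarrow> U l \<times> U l' \<subseteq> G)" by blast
  then have U: "open (U l)" "U l \<inter> Z \<noteq> {}" "U l \<subseteq> V l" "(l, l', G) \<in> T \<Longrightarrow> U l \<times> U l' \<subseteq> G" for l l' G
    by blast+
  have G: "l0 \<noteq> l1" "open G" and "\<exists>x\<in>U l0 \<inter> Z. \<exists>y\<in>U l1 \<inter> Z. (x, y) \<in> G"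
    using insert.prems[of l0 l1 G] U t by auto
  then obtain x y where xy: "x \<in> U l0" "x \<in> Z" "y \<in> U l1" "y \<in> Z" "(x, y) \<in> G" by blast
  obtain A B where AB: "open A" "open B" "x \<in> A" "y \<in> B" "A \<times> B \<subseteq> G"
    by (rule open_prod_elim[OF G(2) xy(5)], rule that) auto
  let ?U = "U(l0 := U l0 \<inter> A, l1 := U l1 \<inter> B)"
  have sub: "?U l \<subseteq> U l" for l by auto
  have "open (?U l) \<and> ?U l \<inter> Z \<noteq> {} \<and> ?U l \<subseteq> V l \<and>
      (\<forall>l' G. (l, l', G) \<in> insert t T \<longrightarrow> ?U l \<times> ?U l' \<subseteq> G)" for l
  proof (intro conjI allI impI)
    show "open (?U l)" using U(1) AB by auto
    show "?U l \<inter> Z \<noteq> {}" using U(2) AB xy by auto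
    show "?U l \<subseteq> V l" using sub U(3) by blast
    fix l' G' assume "(l, l', G') \<in> insert t T"
    then consider "l = l0" "l' = l1" "G' = G" | "(l, l', G') \<in> T" unfolding t by auto
    then show "?U l \<times> ?U l' \<subseteq> G'"
    proof cases
      case 1
      then show ?thesis using AB(5) G(1) by auto
    next
      case 2
      have "?U l \<times> ?U l' \<subseteq> U l \<times> U l'" using sub by (meson Sigma_mono)
      then show ?thesis using U(4)[OF 2] by blast
    qed
  qed
  then show ?case by blast
qed

text \<open>The points of \<open>M\<close> are the branches of countably many binary trees of open sets.  The tree number
  \<open>m\<close> starts at stage \<open>m\<close> inside the open set \<open>W m\<close>, where the sets \<open>W m\<close> form a countable base for
  \<open>Z\<close>; this makes \<open>M\<close> dense.  At stage \<open>n\<close> only finitely many nodes \<open>(m, w)\<close> are present, with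
  \<open>m \<le> n\<close> and \<open>w\<close> a word of length \<open>n\<close>, so they can be shrunk until any two different nodes have
  their product inside each of \<open>G 0, \<dots>, G n\<close>.  Two different branches pass through different nodes
  at all late stages, so the pair lies in every \<open>G n\<close>.  Irreflexivity of \<open>G n\<close> makes the branches of
  each tree distinct; together with density it forces \<open>Z\<close> to have no isolated points.\<close>

theorem mycielski:
  fixes Z :: "'a :: metric_space set" and G :: "nat \<Rightarrow> ('a \<times> 'a) set"
  assumes Z: "compact Z"
    and G_open: "\<And>n. open (G n)"
    and G_irrefl: "\<And>n x. (x, x) \<notin> G n"
    and G_dense: "\<And>n A B. open A \<Longrightarrow> open B \<Longrightarrow> A \<inter> Z \<noteq> {} \<Longrightarrow> B \<inter> Z \<noteq> {} \<Longrightarrow>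
       \<exists>x\<in>A \<inter> Z. \<exists>y\<in>B \<inter> Z. (x, y) \<in> G n"
  obtains M where "dense_mycielski_subset M Z" "\<And>x y n. x \<in> M \<Longrightarrow> y \<in> M \<Longrightarrow> x \<noteq> y \<Longrightarrow> (x, y) \<in> G n"
proof (cases "Z = {}")
  case True
  have "dense_mycielski_subset {} Z"
    unfolding dense_mycielski_subset_def mycielski_set_def using True by auto
  then show ?thesis using that by blast
next
  case False
  have "\<exists>k. finite k \<and> k \<subseteq> Z \<and> Z \<subseteq> (\<Union>x\<in>k. ball x (1 / Suc n))" for n
    using seq_compact_imp_totally_bounded[OF compact_imp_seq_compact[OF Z]] by simp
  then obtain k where k: "\<And>n. finite (k n)" "\<And>n. k n \<subseteq> Z" "\<And>n. Z \<subseteq> (\<Union>x\<in>k n. ball x (1 / Suc n))"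
    by metis
  have "k 0 \<noteq> {}" using k(3)[of 0] False by auto
  moreover have "countable (\<Union>n. k n \<times> {n})" using k(1) by (intro countable_UN) (auto intro: countable_finite)
  ultimately obtain p :: "nat \<Rightarrow> 'a \<times> nat" where p: "range p = (\<Union>n. k n \<times> {n})"
    using uncountable_def[of "\<Union>n. k n \<times> {n}"] by blast
  have p_Z: "fst (p m) \<in> Z" for m
  proof -
    have "p m \<in> (\<Union>n. k n \<times> {n})" using p by blast
    then show ?thesis using k(2) by fastforce
  qed
  define W where "W m = ball (fst (p m)) (1 / Suc (snd (p m)))" for m
  have W: "open (W m) \<and> W m \<inter> Z \<noteq> {}" for m
  proof -
    have "fst (p m) \<in> W m \<inter> Z" unfolding W_def using p_Z[of m] by simp
    then show ?thesis unfolding W_def by blast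
  qed
  \<comment> \<open>Whole words of length \<open>n\<close> are used even for a tree that starts at stage \<open>m > 0\<close>; that tree then
    has \<open>2 ^ m\<close> roots, all inside \<open>W m\<close>.\<close>
  define L where "L n = {..n} \<times> {w :: bool list. length w = n}" for n :: nat
  have fin_L: "finite (L n)" for n
    unfolding L_def using finite_lists_length_eq[of "UNIV :: bool set" n] by (intro finite_SigmaI) (auto simp: Collect_conj_eq)
  define good where "good n U \<longleftrightarrow> (\<forall>l. open (U l) \<and> U l \<inter> Z \<noteq> {} \<and> (\<forall>x\<in>U l. \<forall>y\<in>U l. dist x y \<le> 2 / Suc n)) \<and>
      (\<forall>l\<in>L n. \<forall>l'\<in>L n. l \<noteq> l' \<longrightarrow> (\<forall>j\<le>n. U l \<times> U l' \<subseteq> G j))" for n and U :: "nat \<times> bool list \<Rightarrow> 'a set"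
  define parent where "parent n U l = (if fst l \<le> n then U (fst l, butlast (snd l)) else W (fst l))"
    for n and U :: "nat \<times> bool list \<Rightarrow> 'a set" and l
  have refine: "\<exists>U. good n U \<and> (\<forall>l. closure (U l) \<subseteq> V l)"
    if V: "\<And>l. open (V l) \<and> V l \<inter> Z \<noteq> {}" for n and V :: "nat \<times> bool list \<Rightarrow> 'a set"
  proof -
    let ?T = "(\<lambda>((l, l'), j). (l, l', G j)) ` ({(l, l'). l \<in> L n \<and> l' \<in> L n \<and> l \<noteq> l'} \<times> {..n})"
    have fin: "finite ?T"
      by (intro finite_imageI finite_SigmaI finite_subset[OF _ finite_cartesian_product[OF fin_L fin_L]])
        auto
    have "\<exists>U. \<forall>l. open (U l) \<and> U l \<inter> Z \<noteq> {} \<and> U l \<subseteq> V l \<and>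
           (\<forall>l' G. (l, l', G) \<in> ?T \<longrightarrow> U l \<times> U l' \<subseteq> G)"
      by (rule open_rectangles_refinement[OF fin V]) (auto intro: G_open dest: G_dense)
    then obtain U where "\<forall>l. open (U l) \<and> U l \<inter> Z \<noteq> {} \<and> U l \<subseteq> V l \<and>
           (\<forall>l' G. (l, l', G) \<in> ?T \<longrightarrow> U l \<times> U l' \<subseteq> G)" by blast
    then have U: "open (U l)" "U l \<inter> Z \<noteq> {}" "U l \<subseteq> V l" "(l, l', G) \<in> ?T \<Longrightarrow> U l \<times> U l' \<subseteq> G" for l l' G
      by blast+
    have "\<exists>x r. x \<in> Z \<and> 0 < r \<and> cball x r \<subseteq> U l" for l
      using U(1,2)[of l] open_contains_cball[of "U l"] by blast
    then obtain x r where xr: "\<And>l. x l \<in> Z" "\<And>l. 0 < (r l :: real)" "\<And>l. cball (x l) (r l) \<subseteq> U l" by metis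
    define U' where "U' l = ball (x l) (min (r l) (1 / Suc n))" for l
    have closure_U': "closure (U' l) \<subseteq> U l" for l
    proof -
      have "closure (U' l) \<subseteq> cball (x l) (r l)"
        unfolding U'_def by (rule closure_minimal) auto
      then show ?thesis using xr(3) by blast
    qed
    have U'_U: "U' l \<subseteq> U l" for l using closure_U' closure_subset by blast
    have "good n U'" unfolding good_def
    proof (intro conjI allI ballI impI)
      fix l
      show "open (U' l)" unfolding U'_def by simp
      have "x l \<in> U' l" unfolding U'_def using xr(2) by simp
      then show "U' l \<inter> Z \<noteq> {}" using xr(1) by blast
      fix a b assume "a \<in> U' l" "b \<in> U' l"
      then have "dist (x l) a < 1 / Suc n" "dist (x l) b < 1 / Suc n" unfolding U'_def by auto
      moreover have "(2::real) / Suc n = 1 / Suc n + 1 / Suc n" by simp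
      ultimately show "dist a b \<le> 2 / Suc n" using dist_triangle3[of a b "x l"] by linarith
    next
      fix l l' j assume "l \<in> L n" "l' \<in> L n" "l \<noteq> l'" "j \<le> n"
      then have "(l, l', G j) \<in> ?T" by force
      then have "U l \<times> U l' \<subseteq> G j" by (rule U(4))
      then show "U' l \<times> U' l' \<subseteq> G j" using U'_U Sigma_mono by blast
    qed
    then show ?thesis using closure_U' U(3) by blast
  qed
  have "\<exists>U. \<forall>n. (good n (U n) \<and> (n = 0 \<longrightarrow> U n (0, []) \<subseteq> W 0)) \<and> (\<forall>l. closure (U (Suc n) l) \<subseteq> parent n (U n) l)"
  proof (rule dependent_nat_choice)
    obtain U where "good 0 U" "\<forall>l. closure (U l) \<subseteq> W 0" 
      using refine[of "\<lambda>_. W 0" 0, OF W] by blast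
    then show "\<exists>U. good 0 U \<and> (0 = (0::nat) \<longrightarrow> U (0, []) \<subseteq> W 0)" using closure_subset by blast
  next
    fix U n assume "good n U \<and> (n = 0 \<longrightarrow> U (0, []) \<subseteq> W 0)"
    then have "open (parent n U l) \<and> parent n U l \<inter> Z \<noteq> {}" for l
      unfolding parent_def good_def using W by auto
    from refine[of "parent n U" "Suc n", OF this]
    show "\<exists>U'. (good (Suc n) U' \<and> (Suc n = 0 \<longrightarrow> U' (0, []) \<subseteq> W 0)) \<and> (\<forall>l. closure (U' l) \<subseteq> parent n U l)"
      by blast
  qed
  then obtain U where good: "\<And>n. good n (U n)" and U0: "U 0 (0, []) \<subseteq> W 0"
    and parent: "\<And>n l. closure (U (Suc n) l) \<subseteq> parent n (U n) l"
    by metis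
  define node where "node n m a = U n (m, map a [0..<n])" for n m and a :: "nat \<Rightarrow> bool"
  have node_Suc: "closure (node (Suc n) m a) \<subseteq> node n m a" if "m \<le> n" for n m a
    using parent[of n "(m, map a [0..<Suc n])"] that unfolding node_def parent_def by (simp add: butlast_append)
  have node_W: "node m m a \<subseteq> W m" for m a
  proof (cases m)
    case 0
    then show ?thesis using U0 by (simp add: node_def)
  next
    case (Suc n)
    have "closure (node (Suc n) (Suc n) a) \<subseteq> W (Suc n)"
      using parent[of n "(Suc n, map a [0..<Suc n])"] unfolding node_def parent_def by simp
    then show ?thesis using Suc closure_subset by blast
  qed
  have "\<exists>x. x \<in> Z \<and> (\<forall>n\<ge>m. x \<in> node n m a)" for m a
  proof -
    let ?F = "\<lambda>n. Z \<inter> closure (node (m + n) m a)"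
    have dec: "closure (node (Suc n + m) m a) \<subseteq> closure (node (n + m) m a)" for n
      using node_Suc[of m "n + m" a] closure_subset[of "node (n + m) m a"] by (simp add: subset_trans)
    have anti: "closure (node (m + n) m a) \<subseteq> closure (node (m + n') m a)" if "n' \<le> n" for n n'
      using lift_Suc_antimono_le[of "\<lambda>n. closure (node (n + m) m a)", OF dec that] by (simp add: add.commute)
    have ne: "?F n \<noteq> {}" for n
      using good[of "m + n"] closure_subset[of "node (m + n) m a"] unfolding good_def node_def by blast
    have "Z \<inter> \<Inter>(range (\<lambda>n. closure (node (m + n) m a))) \<noteq> {}"
    proof (rule compact_imp_fip[OF Z])
      show "closed T" if "T \<in> range (\<lambda>n. closure (node (m + n) m a))" for T using that by auto
      fix F' assume "finite F'" "F' \<subseteq> range (\<lambda>n. closure (node (m + n) m a))"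
      then obtain N where N: "finite N" "F' = (\<lambda>n. closure (node (m + n) m a)) ` N"
        by (meson finite_subset_image)
      have "?F (Max (insert 0 N)) \<subseteq> Z \<inter> \<Inter>F'"
        using N anti by auto (meson Max_ge finite_insert insertI2 subsetD)
      then show "Z \<inter> \<Inter>F' \<noteq> {}" using ne by blast
    qed
    then obtain x where x: "x \<in> Z" "\<And>n. x \<in> closure (node (m + n) m a)" by blast
    have "x \<in> node n m a" if "m \<le> n" for n
      using x(2)[of "Suc (n - m)"] node_Suc[OF that, of a] that by auto
    then show ?thesis using x(1) by blast
  qed
  then obtain e where e: "\<And>m a. e m a \<in> Z" "\<And>m a n. m \<le> n \<Longrightarrow> e m a \<in> node n m a" by metis
  have sep: "(e m a, e m' a') \<in> G j" if ne: "(m, a) \<noteq> (m', a')" for m a m' a' j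
  proof -
    obtain i where i: "m \<noteq> m' \<or> a i \<noteq> a' i" using ne by auto
    let ?n = "m + m' + j + Suc i"
    have "(m, map a [0..<?n]) \<noteq> (m', map a' [0..<?n])"
    proof
      assume eq: "(m, map a [0..<?n]) = (m', map a' [0..<?n])"
      then have "map a [0..<?n] ! i = map a' [0..<?n] ! i" by (simp del: upt_Suc)
      then show False using i eq by (simp del: upt_Suc)
    qed
    then have "U ?n (m, map a [0..<?n]) \<times> U ?n (m', map a' [0..<?n]) \<subseteq> G j"
      using good[of ?n] unfolding good_def L_def by (auto simp del: upt_Suc)
    moreover have "e m a \<in> node ?n m a" "e m' a' \<in> node ?n m' a'" using e(2) by simp_all
    ultimately show ?thesis unfolding node_def by blast
  qed
  have inj: "inj (e m)" for m
  proof (rule injI, rule ccontr)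
    fix a b assume "e m a = e m b" "a \<noteq> b"
    then show False using sep[of m a m b 0] G_irrefl by auto
  qed
  have cont: "continuous_on UNIV (e m)" for m
  proof (rule continuous_on_bool_sequences)
    fix \<epsilon> :: real assume "0 < \<epsilon>"
    then obtain n0 :: nat where "2 / \<epsilon> < n0" using reals_Archimedean2 by blast
    then have "2 < \<epsilon> * n0" using \<open>0 < \<epsilon>\<close> by (simp add: field_simps)
    also have "\<dots> \<le> \<epsilon> * Suc (m + n0)" using \<open>0 < \<epsilon>\<close> by (intro mult_left_mono) auto
    finally have n0: "2 / Suc (m + n0) < \<epsilon>" by (simp add: divide_less_eq)
    have "dist (e m a) (e m b) < \<epsilon>" if "\<forall>i<m + n0. a i = b i" for a b
    proof -
      have "node (m + n0) m a = node (m + n0) m b" unfolding node_def using that by (auto intro!: arg_cong[of _ _ "U _"])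
      then have "e m a \<in> node (m + n0) m a" "e m b \<in> node (m + n0) m a" using e(2)[of m "m + n0"] by auto
      then have "dist (e m a) (e m b) \<le> 2 / Suc (m + n0)" using good[of "m + n0"] unfolding good_def node_def by blast
      then show ?thesis using n0 by simp
    qed
    then show "\<exists>n. \<forall>a b. (\<forall>i<n. a i = b i) \<longrightarrow> dist (e m a) (e m b) < \<epsilon>" by blast
  qed
  let ?M = "\<Union>m. range (e m)"
  have "Z \<subseteq> closure ?M"
  proof
    fix z assume z: "z \<in> Z"
    show "z \<in> closure ?M" unfolding closure_approachable
    proof (intro allI impI)
      fix \<epsilon> :: real assume "0 < \<epsilon>"
      then obtain n :: nat where "2 / \<epsilon> < n" using reals_Archimedean2 by blast
      then have "2 < \<epsilon> * n" using \<open>0 < \<epsilon>\<close> by (simp add: field_simps)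
      also have "\<dots> \<le> \<epsilon> * Suc n" using \<open>0 < \<epsilon>\<close> by (intro mult_left_mono) auto
      finally have n: "2 / Suc n < \<epsilon>" by (simp add: divide_less_eq)
      obtain x where x: "x \<in> k n" "dist x z < 1 / Suc n" using k(3)[of n] z by auto
      then have "(x, n) \<in> range p" unfolding p by blast
      then obtain m where m: "p m = (x, n)" by auto
      have "e m (\<lambda>_. False) \<in> W m" using e(2)[of m m] node_W by blast
      then have "dist x (e m (\<lambda>_. False)) < 1 / Suc n" unfolding W_def m by simp
      then have "dist (e m (\<lambda>_. False)) z < 1 / Suc n + 1 / Suc n"
        using x(2) dist_triangle3[of "e m (\<lambda>_. False)" z x] by linarith
      also have "\<dots> = 2 / Suc n" by simp
      finally show "\<exists>y\<in>?M. dist y z < \<epsilon>" using n by (intro bexI[of _ "e m (\<lambda>_. False)"]) auto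
    qed
  qed
  then have "dense_mycielski_subset ?M Z"
    unfolding dense_mycielski_subset_def mycielski_set_def
    using e(1) range_homeomorphic_cantor_set[OF cont inj]
    by (intro conjI exI[of _ "range (\<lambda>m. range (e m))"]) auto
  moreover have "(x, y) \<in> G n" if "x \<in> ?M" "y \<in> ?M" "x \<noteq> y" for x y n
    using that sep by auto metis
  ultimately show ?thesis using that by blast
qed

section \<open>Mixing sequences of events\<close>

text \<open>Renyi's notion of a strongly mixing sequence of events, with the densities \<open>measure M (A i)\<close>
  allowed to vary with \<open>i\<close>.\<close>

definition mixing_events :: "'a measure \<Rightarrow> (nat \<Rightarrow> 'a set) \<Rightarrow> bool" where
  "mixing_events M A \<longleftrightarrow> (\<forall>i. A i \<in> sets M) \<and>
     (\<forall>W\<in>sets M. (\<lambda>i. measure M (W \<inter> A i) - measure M W * measure M (A i)) \<longlonglongrightarrow> 0)"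

text \<open>The sets \<open>W\<close> satisfying the limit relation form a Dynkin system: complements are immediate, and for
  countable disjoint unions the \<open>n\<close>-th summand is bounded by \<open>prob (D n)\<close> uniformly in \<open>i\<close>, so that
  limit and sum can be exchanged.\<close>

lemma (in prob_space) mixing_eventsI_generator:
  assumes E: "Int_stable E" "E \<subseteq> Pow (space M)" "sets M = sigma_sets (space M) E"
    and A: "\<And>i. A i \<in> sets M"
    and lim: "\<And>W. W \<in> E \<Longrightarrow> (\<lambda>i. prob (W \<inter> A i) - prob W * prob (A i)) \<longlonglongrightarrow> 0"
  shows "mixing_events M A"
  unfolding mixing_events_def
proof (intro conjI ballI allI A)
  fix W assume "W \<in> sets M"
  then have "W \<in> sigma_sets (space M) E" using E(3) by simp
  then show "(\<lambda>i. prob (W \<inter> A i) - prob W * prob (A i)) \<longlonglongrightarrow> 0"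
  proof (induction W rule: sigma_sets_induct_disjoint[OF E(1,2), consumes 1, case_names basic empty compl union])
    case (basic W)
    then show ?case by (rule lim)
  next
    case empty
    then show ?case by simp
  next
    case (compl W)
    then have W: "W \<in> sets M" using E(3) by simp
    have "prob ((space M - W) \<inter> A i) - prob (space M - W) * prob (A i) =
        - (prob (W \<inter> A i) - prob W * prob (A i))" for i
    proof -
      have "(space M - W) \<inter> A i = A i - (W \<inter> A i)" using sets.sets_into_space[OF A] by auto
      then have "prob ((space M - W) \<inter> A i) = prob (A i) - prob (W \<inter> A i)"
        using finite_measure_Diff[of "A i" "W \<inter> A i"] A W by simp
      then show ?thesis unfolding prob_compl[OF W] by (simp add: left_diff_distrib)
    qed
    then show ?case using tendsto_minus[OF compl(2)] by simp
  next
    case (union D)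
    have D: "range D \<subseteq> sets M" using union(2) E(3) by simp
    then have Dn: "D n \<in> sets M" for n by auto
    let ?f = "\<lambda>n i. prob (D n \<inter> A i) - prob (D n) * prob (A i)"
    have s: "(\<lambda>n. prob (D n)) sums prob (\<Union>(range D))"
      by (rule finite_measure_UNION) (use D union(1) in auto)
    have disj: "disjoint_family (\<lambda>n. D n \<inter> A i)" for i
      using union(1) unfolding disjoint_family_on_def by blast
    have sA: "(\<lambda>n. prob (D n \<inter> A i)) sums prob (\<Union>(range D) \<inter> A i)" for i
    proof -
      have "(\<lambda>n. prob (D n \<inter> A i)) sums prob (\<Union>n. D n \<inter> A i)"
        by (rule finite_measure_UNION) (use Dn A disj in auto)
      then show ?thesis by (simp add: UN_simps)
    qed
    have "(\<lambda>n. ?f n i) sums (prob (\<Union>(range D) \<inter> A i) - prob (\<Union>(range D)) * prob (A i))" for i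
      by (intro sums_diff sA sums_mult2 s)
    then have eq: "prob (\<Union>(range D) \<inter> A i) - prob (\<Union>(range D)) * prob (A i) = (\<Sum>n. ?f n i)" for i
      by (simp add: sums_iff)
    have bound: "norm (?f n i) \<le> prob (D n)" for n i
    proof -
      have "prob (D n \<inter> A i) \<le> prob (D n)" by (intro finite_measure_mono) (use Dn in auto)
      moreover have "prob (D n) * prob (A i) \<le> prob (D n)" by (intro mult_right_le_one_le) auto
      moreover have "0 \<le> prob (D n \<inter> A i)" "0 \<le> prob (D n) * prob (A i)" by auto
      ultimately show ?thesis unfolding real_norm_def by (intro abs_leI; linarith)
    qed
    have "(\<lambda>i. \<Sum>n. ?f n i) \<longlonglongrightarrow> (\<Sum>n. 0)"
      using tannerys_theorem[of "\<lambda>n i. ?f n i" "\<lambda>_. 0" sequentially "\<lambda>n. prob (D n)"]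
        union(3) bound sums_summable[OF s] by (simp add: always_eventually)
    then show ?case unfolding eq by simp
  qed
qed

lemma measure_pair_times:
  assumes "prob_space M" "prob_space N" "A \<in> sets M" "B \<in> sets N"
  shows "measure (M \<Otimes>\<^sub>M N) (A \<times> B) = measure M A * measure N B"
proof -
  interpret M: prob_space M by fact
  interpret N: prob_space N by fact
  show ?thesis
    using N.emeasure_pair_measure_Times[OF assms(3,4)]
    by (simp add: measure_def enn2real_mult)
qed

text \<open>By the generator criterion it suffices to test rectangles, for which the probabilities factor.\<close>

lemma mixing_events_times:
  assumes MN: "prob_space M" "prob_space N" and A: "mixing_events M A" and B: "mixing_events N B"
  shows "mixing_events (M \<Otimes>\<^sub>M N) (\<lambda>i. A i \<times> B i)"
proof -
  interpret P: prob_space "M \<Otimes>\<^sub>M N" by (rule prob_space_pair[OF MN])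
  interpret M: prob_space M by fact
  interpret N: prob_space N by fact
  let ?E = "{a \<times> b | a b. a \<in> sets M \<and> b \<in> sets N}"
  have As: "A i \<in> sets M" and Bs: "B i \<in> sets N" for i using A B by (auto simp: mixing_events_def)
  show ?thesis
  proof (rule P.mixing_eventsI_generator[of ?E])
    show "Int_stable ?E" by (rule Int_stable_pair_measure_generator)
    show "?E \<subseteq> Pow (space (M \<Otimes>\<^sub>M N))"
      using pair_measure_closed[of M N] by (simp add: space_pair_measure)
    show "sets (M \<Otimes>\<^sub>M N) = sigma_sets (space (M \<Otimes>\<^sub>M N)) ?E"
      by (simp add: sets_pair_measure space_pair_measure)
    show "A i \<times> B i \<in> sets (M \<Otimes>\<^sub>M N)" for i using As Bs by simp
  next
    fix W assume "W \<in> ?E"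
    then obtain a b where ab: "a \<in> sets M" "b \<in> sets N" and W: "W = a \<times> b" by auto
    let ?x = "\<lambda>i. measure M (a \<inter> A i) - measure M a * measure M (A i)"
    let ?y = "\<lambda>i. measure N (b \<inter> B i) - measure N b * measure N (B i)"
    have x: "?x \<longlonglongrightarrow> 0" and y: "?y \<longlonglongrightarrow> 0" using A B ab by (auto simp: mixing_events_def)
    have "(\<lambda>i. ?x i * measure N (b \<inter> B i)) \<longlonglongrightarrow> 0"
      by (rule Lim_null_comparison[OF _ tendsto_rabs_zero[OF x]])
        (auto intro!: always_eventually mult_right_le_one_le simp: abs_mult)
    moreover have "(\<lambda>i. (measure M a * measure M (A i)) * ?y i) \<longlonglongrightarrow> 0"
      by (rule Lim_null_comparison[OF _ tendsto_rabs_zero[OF y]])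
        (auto intro!: always_eventually mult_left_le_one_le mult_le_one simp: abs_mult)
    ultimately
    have "(\<lambda>i. ?x i * measure N (b \<inter> B i) + (measure M a * measure M (A i)) * ?y i) \<longlonglongrightarrow> 0"
      using tendsto_add by fastforce
    moreover have "measure (M \<Otimes>\<^sub>M N) (W \<inter> A i \<times> B i) - measure (M \<Otimes>\<^sub>M N) W * measure (M \<Otimes>\<^sub>M N) (A i \<times> B i)
       = ?x i * measure N (b \<inter> B i) + (measure M a * measure M (A i)) * ?y i" for i
      unfolding W Times_Int_Times using ab As Bs
      by (simp add: measure_pair_times[OF MN] algebra_simps)
    ultimately show "(\<lambda>i. measure (M \<Otimes>\<^sub>M N) (W \<inter> A i \<times> B i) -
        measure (M \<Otimes>\<^sub>M N) W * measure (M \<Otimes>\<^sub>M N) (A i \<times> B i)) \<longlonglongrightarrow> 0"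
      by simp
  qed
qed

lemma (in prob_space) mixing_events_disjoint_UN:
  assumes "finite J" and A: "\<And>j. j \<in> J \<Longrightarrow> mixing_events M (A j)"
    and disj: "\<And>i. disjoint_family_on (\<lambda>j. A j i) J"
  shows "mixing_events M (\<lambda>i. \<Union>j\<in>J. A j i)"
  unfolding mixing_events_def
proof (intro conjI allI ballI)
  have As: "A j i \<in> sets M" if "j \<in> J" for j i using A[OF that] by (auto simp: mixing_events_def)
  show "(\<Union>j\<in>J. A j i) \<in> sets M" for i using As \<open>finite J\<close> by auto
  fix W assume W: "W \<in> sets M"
  have "prob (\<Union>j\<in>J. A j i) = (\<Sum>j\<in>J. prob (A j i))" for i
    by (rule finite_measure_finite_Union) (use As disj \<open>finite J\<close> in auto)
  moreover have "disjoint_family_on (\<lambda>j. W \<inter> A j i) J" for i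
    using disj[of i] unfolding disjoint_family_on_def by blast
  moreover have "prob (W \<inter> (\<Union>j\<in>J. A j i)) = (\<Sum>j\<in>J. prob (W \<inter> A j i))"
    if "disjoint_family_on (\<lambda>j. W \<inter> A j i) J" for i
    unfolding Int_UN_distrib
    by (rule finite_measure_finite_Union[OF \<open>finite J\<close> _ that]) (use As W in auto)
  ultimately have "prob (W \<inter> (\<Union>j\<in>J. A j i)) - prob W * prob (\<Union>j\<in>J. A j i) =
      (\<Sum>j\<in>J. prob (W \<inter> A j i) - prob W * prob (A j i))" for i
    by (simp add: sum_subtractf sum_distrib_left)
  moreover have "(\<lambda>i. \<Sum>j\<in>J. prob (W \<inter> A j i) - prob W * prob (A j i)) \<longlonglongrightarrow> (\<Sum>j\<in>J. 0)"
    using A W by (intro tendsto_sum) (auto simp: mixing_events_def)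
  ultimately show "(\<lambda>i. prob (W \<inter> (\<Union>j\<in>J. A j i)) - prob W * prob (\<Union>j\<in>J. A j i)) \<longlonglongrightarrow> 0"
    by simp
qed

text \<open>A replacement for the second Borel--Cantelli lemma without independence.  If the set \<open>W n\<close> of points
  that miss all \<open>A i\<close> with \<open>i \<ge> n\<close> had positive probability, then along the indices with
  \<open>\<kappa> \<le> prob (A i)\<close> the mixing relation would give \<open>W n \<inter> A i\<close> probability about
  \<open>prob (W n) * prob (A i)\<close>, which is bounded away from 0, although this intersection is empty.\<close>

lemma (in prob_space) mixing_events_infinitely_often:
  assumes A: "mixing_events M A" and "0 < \<kappa>" and often: "\<exists>\<^sub>F i in sequentially. \<kappa> \<le> prob (A i)"
  shows "AE x in M. \<exists>\<^sub>F i in sequentially. x \<in> A i"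
proof -
  have As[measurable]: "A i \<in> sets M" for i using A by (auto simp: mixing_events_def)
  define W where "W n = space M - (\<Union>i\<in>{n..}. A i)" for n
  have Ws: "W n \<in> sets M" for n unfolding W_def by measurable
  have "prob (W n) = 0" for n
  proof (rule ccontr)
    assume "prob (W n) \<noteq> 0"
    then have pos: "0 < prob (W n)" by (simp add: zero_less_measure_iff)
    have "(\<lambda>i. prob (W n \<inter> A i) - prob (W n) * prob (A i)) \<longlonglongrightarrow> 0"
      using A Ws by (auto simp: mixing_events_def)
    then have "\<forall>\<^sub>F i in sequentially. - (prob (W n) * \<kappa>) < prob (W n \<inter> A i) - prob (W n) * prob (A i)"
      by (rule order_tendstoD) (use pos \<open>0 < \<kappa>\<close> in simp)
    moreover have "\<forall>\<^sub>F i in sequentially. n \<le> i" by (rule eventually_ge_at_top)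
    ultimately have "\<exists>\<^sub>F i in sequentially. \<kappa> \<le> prob (A i) \<and>
        (- (prob (W n) * \<kappa>) < prob (W n \<inter> A i) - prob (W n) * prob (A i)) \<and> n \<le> i"
      using often by (intro frequently_eventually_frequently eventually_conj)
    then obtain i where i: "\<kappa> \<le> prob (A i)" "n \<le> i"
       "- (prob (W n) * \<kappa>) < prob (W n \<inter> A i) - prob (W n) * prob (A i)"
      by (auto dest: frequently_ex)
    have "W n \<inter> A i = {}" unfolding W_def using i(2) by auto
    then have "prob (W n) * prob (A i) < prob (W n) * \<kappa>" using i(3) by simp
    then show False using i(1) pos by (simp add: mult_less_cancel_left_pos)
  qed
  then have "AE x in M. x \<notin> W n" for n
    using Ws by (intro AE_not_in) (simp add: null_sets_def emeasure_eq_measure)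
  then have "AE x in M. \<forall>n. x \<notin> W n" by (simp add: AE_all_countable)
  with AE_space show ?thesis
  proof eventually_elim
    case (elim x)
    then show ?case unfolding W_def frequently_sequentially by auto
  qed
qed

section \<open>Refining finite partitions and the mass of the diagonal\<close>

text \<open>Two points have the same label at level \<open>k\<close> iff they lie in the same cell of the \<open>k\<close>-th of a
  refining sequence of finite Borel partitions whose mesh tends to 0.  Every open set
  is a countable union of cells, so the cells play the role of a countable base of the topology.\<close>

locale refining_labels =
  fixes c :: "nat \<Rightarrow> 'x :: metric_space \<Rightarrow> nat"
  assumes finite_labels: "finite (range (c k))"
    and label_sets: "c k -` {j} \<in> sets borel"
    and refine: "c (Suc k) x = c (Suc k) x' \<Longrightarrow> c k x = c k x'"
    and label_dist: "c k x = c k x' \<Longrightarrow> dist x x' < 1 / Suc k"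

text \<open>The label at level \<open>k\<close> encodes, for all \<open>n \<le> k\<close>, the first ball containing the point in a list of
  balls of radius \<open>1 / (2 * Suc n)\<close> that covers the space.\<close>

lemma refining_labels_exist:
  assumes "compact (UNIV :: 'x :: metric_space set)"
  obtains c :: "nat \<Rightarrow> 'x :: metric_space \<Rightarrow> nat" where "refining_labels c"
proof -
  have "\<exists>xs :: 'x list. UNIV \<subseteq> (\<Union>x\<in>set xs. ball x (1 / (2 * Suc n)))" for n
    using seq_compact_imp_totally_bounded[OF compact_imp_seq_compact[OF assms], rule_format, of "1 / (2 * Suc n)"]
      finite_list by (metis of_nat_0_less_iff zero_less_divide_1_iff zero_less_Suc mult_pos_pos zero_less_numeral)
  then obtain xs :: "nat \<Rightarrow> 'x list" where xs: "\<And>n. UNIV \<subseteq> (\<Union>x\<in>set (xs n). ball x (1 / (2 * Suc n)))" by metis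
  define b where "b n x = (LEAST i. i < length (xs n) \<and> dist (xs n ! i) x < 1 / (2 * Suc n))" for n x
  have ex: "\<exists>i. i < length (xs n) \<and> dist (xs n ! i) x < 1 / (2 * Suc n)" for n x
  proof -
    have "x \<in> (\<Union>a\<in>set (xs n). ball a (1 / (2 * Suc n)))" using xs[of n] by blast
    then obtain a where "a \<in> set (xs n)" "dist a x < 1 / (2 * Suc n)" by auto
    then show ?thesis by (metis in_set_conv_nth)
  qed
  have b: "b n x < length (xs n)" "dist (xs n ! b n x) x < 1 / (2 * Suc n)" for n x
    unfolding b_def using LeastI_ex[OF ex[of n x]] by auto
  have b_meas: "b n \<in> measurable borel (count_space UNIV)" for n
  proof -
    have [measurable]: "Measurable.pred borel (\<lambda>x :: 'x. dist a x < r)" for a r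
      unfolding pred_def by (intro borel_open) (simp add: open_Collect_less continuous_intros)
    show ?thesis unfolding b_def by measurable
  qed
  define c where "c = rec_nat (b 0) (\<lambda>k ck x. prod_encode (ck x, b (Suc k) x))"
  have c0: "c 0 = b 0" and cS: "c (Suc k) = (\<lambda>x. prod_encode (c k x, b (Suc k) x))" for k
    by (simp_all add: c_def)
  have c_meas: "c k \<in> measurable borel (count_space UNIV)" for k
  proof (induction k)
    case 0
    then show ?case using b_meas c0 by simp
  next
    case (Suc k)
    note [measurable] = Suc b_meas[of "Suc k"]
    show ?case unfolding cS by measurable
  qed
  have c_b: "c k x = c k x' \<Longrightarrow> b k x = b k x'" for k x x'
    by (cases k) (simp_all add: c0 cS)
  have "refining_labels c"
  proof
    show "finite (range (c k))" for k
    proof (induction k)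
      case 0
      have "range (c 0) \<subseteq> {..<length (xs 0)}" using b(1) unfolding c0 by auto
      then show ?case by (rule finite_subset) simp
    next
      case (Suc k)
      have "range (c (Suc k)) \<subseteq> prod_encode ` (range (c k) \<times> {..<length (xs (Suc k))})"
        using b(1) unfolding cS by auto
      then show ?case by (rule finite_subset) (simp add: Suc)
    qed
    show "c k -` {j} \<in> sets borel" for k j
      using measurable_sets[OF c_meas, of "{j}" k] by simp
    show "c (Suc k) x = c (Suc k) x' \<Longrightarrow> c k x = c k x'" for k x x'
      by (simp add: cS)
    show "dist x x' < 1 / Suc k" if "c k x = c k x'" for k x x'
    proof -
      have "dist (xs k ! b k x) x < 1 / (2 * Suc k)" "dist (xs k ! b k x) x' < 1 / (2 * Suc k)"
        using b(2)[of k x] b(2)[of k x'] c_b[OF that] by simp_all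
      then have "dist x x' < 1 / (2 * Suc k) + 1 / (2 * Suc k)"
        using dist_triangle3[of x x' "xs k ! b k x"] by linarith
      also have "1 / (2 * Suc k) + 1 / (2 * Suc k) = 1 / real (Suc k)" by (simp add: field_simps)
      finally show ?thesis .
    qed
  qed
  then show ?thesis by (rule that)
qed

context refining_labels
begin

abbreviation cell :: "nat \<Rightarrow> nat \<Rightarrow> 'x set" where
  "cell k j \<equiv> c k -` {j}"

lemma refine_le: "k \<le> l \<Longrightarrow> c l x = c l x' \<Longrightarrow> c k x = c k x'"
  by (induction l rule: dec_induct) (auto dest: refine)

lemma label_pair_sets:
  assumes "sets M = sets borel" "sets N = sets borel"
  shows "cell k i \<times> cell l j \<in> sets (M \<Otimes>\<^sub>M N)"
  using label_sets assms by (intro pair_measureI) simp_all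

lemma open_Union_cells:
  assumes "open U"
  shows "U = \<Union>((\<lambda>(k, j). cell k j) ` {(k, j). cell k j \<subseteq> U})"
proof (intro equalityI subsetI)
  fix x assume x: "x \<in> U"
  then obtain e where e: "0 < e" "ball x e \<subseteq> U" using assms open_contains_ball by blast
  then obtain k :: nat where k: "1 / Suc k < e" using nat_approx_posE by blast
  have "cell k (c k x) \<subseteq> ball x e"
  proof
    fix x' assume "x' \<in> cell k (c k x)"
    then have "dist x x' < 1 / Suc k" using label_dist[of k x x'] by simp
    then show "x' \<in> ball x e" using k by simp
  qed
  then show "x \<in> \<Union>((\<lambda>(k, j). cell k j) ` {(k, j). cell k j \<subseteq> U})" using e by force
qed auto

text \<open>Two cells are nested or disjoint; the empty set is itself a cell, because some label is not
  attained.\<close>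

lemma Int_stable_cells: "Int_stable (range (\<lambda>(k, j). cell k j))"
proof (rule Int_stableI)
  have *: "cell k i \<inter> cell l j \<in> range (\<lambda>(k, j). cell k j)" if "k \<le> l" for k i l j
  proof (cases "cell k i \<inter> cell l j = {}")
    case True
    obtain m where "m \<notin> range (c 0)" using finite_labels[of 0] ex_new_if_finite by blast
    then have "{} = (\<lambda>(k, j). cell k j) (0, m)" by auto
    then show ?thesis unfolding True by blast
  next
    case False
    then obtain x where "c k x = i" "c l x = j" by auto
    then have "cell k i \<inter> cell l j = cell l j" using refine_le[OF that] by auto
    then show ?thesis by (metis (mono_tags, lifting) case_prod_conv rangeI)
  qed
  fix A B assume "A \<in> range (\<lambda>(k, j). cell k j)" "B \<in> range (\<lambda>(k, j). cell k j)"
  then obtain k i l j where "A = cell k i" "B = cell l j" by auto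
  then show "A \<inter> B \<in> range (\<lambda>(k, j). cell k j)"
    using *[of k l i j] *[of l k j i] by (cases "k \<le> l") (auto simp: Int_commute)
qed

lemma borel_eq_sigma_cells: "sets borel = sigma_sets UNIV (range (\<lambda>(k, j). cell k j))"
proof
  let ?C = "range (\<lambda>(k, j). cell k j)"
  show "sets borel \<subseteq> sigma_sets UNIV ?C"
    unfolding sets_borel
  proof (rule sigma_sets_mono, rule subsetI)
    fix U :: "'x set" assume "U \<in> {S. open S}"
    then have "open U" by simp
    have "countable {(k, j). cell k j \<subseteq> U}" by (rule countableI_type)
    then have "\<Union>((\<lambda>(k, j). cell k j) ` {(k, j). cell k j \<subseteq> U}) \<in> sigma_sets UNIV ?C"
      by (intro sigma_sets_UNION) auto
    then show "U \<in> sigma_sets UNIV ?C" using open_Union_cells[OF \<open>open U\<close>] by simp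
  qed
  show "sigma_sets UNIV ?C \<subseteq> sets borel"
    using label_sets by (intro sets.sigma_sets_subset[of _ borel, simplified]) auto
qed

definition cell_rectangles :: "nat \<Rightarrow> (nat \<times> nat) set \<Rightarrow> ('x \<times> 'x) set" where
  "cell_rectangles k J = (\<Union>(i, j)\<in>J. cell k i \<times> cell k j)"

definition near :: "nat \<Rightarrow> ('x \<times> 'x) set" where
  "near k = cell_rectangles k ((\<lambda>j. (j, j)) ` range (c k))"

lemma near_eq: "near k = (\<Union>j\<in>range (c k). cell k j \<times> cell k j)"
  unfolding near_def cell_rectangles_def by auto

text \<open>The pairs whose cells are far apart, rather than the pairs of points that are far apart: this
  keeps \<open>far k\<close> a finite union of rectangles.\<close>

definition far_labels :: "nat \<Rightarrow> (nat \<times> nat) set" where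
  "far_labels k = {(i, j) \<in> range (c k) \<times> range (c k). \<forall>x\<in>cell k i. \<forall>x'\<in>cell k j. 1 / Suc k < dist x x'}"

definition far :: "nat \<Rightarrow> ('x \<times> 'x) set" where
  "far k = cell_rectangles k (far_labels k)"

lemma finite_far_labels: "finite (far_labels k)"
  by (rule finite_subset[of _ "range (c k) \<times> range (c k)"]) (auto simp: far_labels_def finite_labels)

lemma mem_near: "(x, x') \<in> near k \<longleftrightarrow> c k x = c k x'"
  unfolding near_eq by auto

lemma mem_far: "(x, x') \<in> far k \<longleftrightarrow> (\<forall>z z'. c k z = c k x \<longrightarrow> c k z' = c k x' \<longrightarrow> 1 / Suc k < dist z z')"
  unfolding far_def cell_rectangles_def far_labels_def by auto

text \<open>The diagonal is thus a countable intersection of finite unions of rectangles; this is how its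
  measurability and its mass under product measures are accessed.\<close>

lemma Inter_near: "(\<Inter>k. near k) = Id"
proof -
  have "x = x'" if "\<And>k. c k x = c k x'" for x x'
  proof (rule ccontr)
    assume "x \<noteq> x'"
    then obtain k :: nat where "1 / Suc k < dist x x'" using nat_approx_posE[of "dist x x'"] by auto
    then show False using label_dist[OF that[of k]] by simp
  qed
  then show ?thesis by (auto simp: mem_near)
qed

lemma decseq_near: "decseq near"
  by (rule decseq_SucI) (auto simp: mem_near intro: refine)

lemma Union_far: "(\<Union>k. far k) = - Id"
proof -
  have "\<exists>k. (x, x') \<in> far k" if "x \<noteq> x'" for x x'
  proof -
    have "0 < dist x x' / 3" using that by simp
    then obtain k :: nat where k: "1 / Suc k < dist x x' / 3" using nat_approx_posE by blast
    have "1 / Suc k < dist z z'" if "c k z = c k x" "c k z' = c k x'" for z z'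
    proof -
      have "dist x x' \<le> dist z x + dist z z' + dist z' x'"
        using dist_triangle[of x x' z] dist_triangle[of z x' z'] by (simp add: dist_commute)
      then show ?thesis using label_dist[OF that(1)] label_dist[OF that(2)] k by linarith
    qed
    then show ?thesis unfolding mem_far by blast
  qed
  moreover have "(x, x) \<notin> far k" for x k unfolding mem_far by (metis dist_self divide_nonneg_nonneg leD of_nat_0_le_iff zero_le_one)
  ultimately show ?thesis by auto blast
qed

lemma incseq_far: "incseq far"
proof (rule incseq_SucI, rule subrelI)
  fix k x x' assume "(x, x') \<in> far k"
  moreover have "1 / real (Suc (Suc k)) \<le> 1 / Suc k" by (simp add: field_simps)
  ultimately show "(x, x') \<in> far (Suc k)" unfolding mem_far by (meson refine order_le_less_trans)
qed

lemma far_disjoint_Id: "far k \<inter> Id = {}"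
  using Union_far by blast

lemma near_sets: "sets M = sets borel \<Longrightarrow> near k \<in> sets (M \<Otimes>\<^sub>M M)"
  unfolding near_eq by (intro sets.finite_UN finite_labels label_pair_sets)

lemma far_sets: "sets M = sets borel \<Longrightarrow> far k \<in> sets (M \<Otimes>\<^sub>M M)"
  unfolding far_def cell_rectangles_def by (intro sets.finite_UN finite_far_labels) (auto intro: label_pair_sets)

lemma Id_sets: "sets (M :: 'x measure) = sets borel \<Longrightarrow> Id \<in> sets (M \<Otimes>\<^sub>M M)"
  unfolding Inter_near[symmetric] by (rule sets.countable_INT) (auto intro: near_sets)

end

locale label_measure = refining_labels c + prob_space M for c :: "nat \<Rightarrow> 'x :: metric_space \<Rightarrow> nat" and M :: "'x :: metric_space measure" +
  assumes sets_M: "sets M = sets borel"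
begin

sublocale square: prob_space "M \<Otimes>\<^sub>M M"
  by (rule prob_space_pair) unfold_locales

lemma space_M: "space M = UNIV"
  using sets_eq_imp_space_eq[OF sets_M] by simp

lemma label_sets_M: "cell k j \<in> sets M"
  using label_sets sets_M by simp

lemma singleton_sets_M: "{x} \<in> sets M"
  using sets_M by simp

lemma prob_square_times: "A \<in> sets M \<Longrightarrow> B \<in> sets M \<Longrightarrow> square.prob (A \<times> B) = prob A * prob B"
  by (rule measure_pair_times) unfold_locales

lemma near_tendsto: "(\<lambda>k. square.prob (near k)) \<longlonglongrightarrow> square.prob Id"
  using square.finite_Lim_measure_decseq[of near] near_sets[OF sets_M] decseq_near
  unfolding Inter_near by auto

lemma far_tendsto: "(\<lambda>k. square.prob (far k)) \<longlonglongrightarrow> 1 - square.prob Id"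
proof -
  have "space (M \<Otimes>\<^sub>M M) - Id = - Id" by (auto simp: space_pair_measure space_M)
  then have "square.prob (- Id) = 1 - square.prob Id"
    using square.prob_compl[OF Id_sets[OF sets_M]] by simp
  moreover have "(\<lambda>k. square.prob (far k)) \<longlonglongrightarrow> square.prob (\<Union>k. far k)"
    by (rule square.finite_Lim_measure_incseq) (use far_sets[OF sets_M] incseq_far in auto)
  ultimately show ?thesis by (simp add: Union_far)
qed

lemma prob_Union_rectangles:
  assumes "finite J" "\<And>p. p \<in> J \<Longrightarrow> A p \<in> sets M" "\<And>p. p \<in> J \<Longrightarrow> B p \<in> sets M"
    and "disjoint_family_on (\<lambda>p. A p \<times> B p) J"
  shows "square.prob (\<Union>p\<in>J. A p \<times> B p) = (\<Sum>p\<in>J. prob (A p) * prob (B p))"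
proof -
  have "square.prob (\<Union>p\<in>J. A p \<times> B p) = (\<Sum>p\<in>J. square.prob (A p \<times> B p))"
    by (rule square.finite_measure_finite_Union) (use assms in auto)
  also have "\<dots> = (\<Sum>p\<in>J. prob (A p) * prob (B p))"
    using assms by (intro sum.cong refl prob_square_times) auto
  finally show ?thesis .
qed

lemma emeasure_diagonal: "emeasure (M \<Otimes>\<^sub>M M) Id = (\<integral>\<^sup>+ x. emeasure M {x} \<partial>M)"
proof -
  have "Pair x -` Id = {x}" for x :: 'x by auto
  then show ?thesis using emeasure_pair_measure_alt[OF Id_sets[OF sets_M]] by simp
qed

text \<open>By Fubini the mass of the diagonal is the integral of the point masses.\<close>

lemma diagonal_eq_0_iff: "square.prob Id = 0 \<longleftrightarrow> (\<forall>x. emeasure M {x} = 0)"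
proof -
  have meas: "(\<lambda>x. emeasure M {x}) \<in> borel_measurable M"
  proof -
    have "Pair x -` Id = {x}" for x :: 'x by auto
    then show ?thesis using measurable_emeasure_Pair[OF Id_sets[OF sets_M]] by simp
  qed
  have "square.prob Id = 0 \<longleftrightarrow> (AE x in M. emeasure M {x} = 0)"
    by (simp add: square.emeasure_eq_measure[symmetric] measure_def emeasure_diagonal
        nn_integral_0_iff_AE[OF meas] enn2real_eq_0_iff flip: emeasure_diagonal)
       (simp add: emeasure_diagonal nn_integral_0_iff_AE[OF meas])
  also have "\<dots> \<longleftrightarrow> (\<forall>x. emeasure M {x} = 0)"
  proof (intro iffI allI)
    fix x assume ae: "AE x in M. emeasure M {x} = 0"
    show "emeasure M {x} = 0"
    proof (rule ccontr)
      assume pos: "emeasure M {x} \<noteq> 0"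
      from ae have "AE z in M. z \<notin> {x}" by eventually_elim (use pos in auto)
      then have "emeasure M {x} = 0" using AE_iff_measurable[OF singleton_sets_M[of x], of "\<lambda>z. z \<notin> {x}"] by (auto simp: space_M)
      then show False using pos by simp
    qed
  qed simp
  finally show ?thesis .
qed

lemma diagonal_eq_1_imp_Dirac:
  assumes "square.prob Id = 1"
  shows "\<exists>x. prob {x} = 1"
proof -
  have [measurable]: "(\<lambda>x. emeasure M {x}) \<in> borel_measurable M"
  proof -
    have "Pair x -` Id = {x}" for x :: 'x by auto
    then show ?thesis using measurable_emeasure_Pair[OF Id_sets[OF sets_M]] by simp
  qed
  interpret P: pair_sigma_finite M M by unfold_locales
  have "AE p in M \<Otimes>\<^sub>M M. p \<in> Id"
    using square.AE_in_set_eq_1[OF Id_sets[OF sets_M]] assms by simp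
  then have "AE x in M. AE x' in M. (x, x') \<in> Id"
    by (rule P.AE_pair)
  then obtain x where "AE x' in M. (x, x') \<in> Id"
    using eventually_happens'[OF ae_filter_bot] by blast
  then have "AE x' in M. x' \<in> {x}" by eventually_elim auto
  then show ?thesis using AE_in_set_eq_1[OF singleton_sets_M] by blast
qed

text \<open>An atom in the sense of the definition meets, at each level, exactly one cell in positive measure, so
  the square of the atom has the same mass as its intersection with \<open>near k\<close>; in the limit this mass
  sits on the diagonal.\<close>

lemma nonatomic_iff_diagonal_null: "nonatomic M \<longleftrightarrow> square.prob Id = 0"
proof
  assume na: "nonatomic M"
  have "emeasure M {x} = 0" for x
  proof (rule ccontr)
    assume "emeasure M {x} \<noteq> 0"
    then have "0 < emeasure M {x}" using not_gr_zero by blast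
    then obtain B where "B \<subseteq> {x}" "0 < emeasure M B" "emeasure M B < emeasure M {x}"
      using na singleton_sets_M unfolding nonatomic_def by blast
    moreover then have "B = {} \<or> B = {x}" by auto
    ultimately show False by auto
  qed
  then show "square.prob Id = 0" unfolding diagonal_eq_0_iff by simp
next
  assume diag: "square.prob Id = 0"
  show "nonatomic M" unfolding nonatomic_def
  proof (intro ballI impI, rule ccontr)
    fix A assume A: "A \<in> sets M" and pos: "0 < emeasure M A"
      and no: "\<not> (\<exists>B\<in>sets M. B \<subseteq> A \<and> 0 < emeasure M B \<and> emeasure M B < emeasure M A)"
    have two: "prob B = 0 \<or> prob B = prob A" if "B \<in> sets M" "B \<subseteq> A" for B
    proof -
      have "emeasure M B \<le> emeasure M A" using that A by (intro emeasure_mono) auto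
      then have "emeasure M B = 0 \<or> emeasure M B = emeasure M A"
        using no that by (metis le_neq_trans not_gr_zero)
      then show ?thesis by (auto simp: measure_def)
    qed
    have "square.prob (near k \<inter> (A \<times> A)) = prob A * prob A" for k
    proof -
      have "near k \<inter> (A \<times> A) = (\<Union>j\<in>range (c k). (cell k j \<inter> A) \<times> (cell k j \<inter> A))"
        unfolding near_eq by auto
      also have "square.prob \<dots> = (\<Sum>j\<in>range (c k). prob (cell k j \<inter> A) * prob (cell k j \<inter> A))"
        by (rule prob_Union_rectangles) (use A label_sets_M finite_labels in \<open>auto simp: disjoint_family_on_def\<close>)
      also have "\<dots> = (\<Sum>j\<in>range (c k). prob (cell k j \<inter> A) * prob A)"
      proof (rule sum.cong[OF refl])
        fix j
        have "cell k j \<inter> A \<in> sets M" using A label_sets_M by blast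
        from two[OF this] show "prob (cell k j \<inter> A) * prob (cell k j \<inter> A) = prob (cell k j \<inter> A) * prob A"
          by auto
      qed
      also have "\<dots> = prob (\<Union>j\<in>range (c k). cell k j \<inter> A) * prob A"
        unfolding sum_distrib_right[symmetric]
        by (subst finite_measure_finite_Union)
          (use A label_sets_M finite_labels in \<open>auto simp: disjoint_family_on_def\<close>)
      also have "(\<Union>j\<in>range (c k). cell k j \<inter> A) = A" by auto
      finally show ?thesis .
    qed
    moreover have "(\<lambda>k. square.prob (near k \<inter> (A \<times> A))) \<longlonglongrightarrow> square.prob (\<Inter>k. near k \<inter> (A \<times> A))"
      using decseq_near near_sets[OF sets_M] A
      by (intro square.finite_Lim_measure_decseq) (auto simp: decseq_def)
    ultimately have "square.prob (\<Inter>k. near k \<inter> (A \<times> A)) = prob A * prob A"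
      by (simp add: LIMSEQ_const_iff)
    moreover have "square.prob (\<Inter>k. near k \<inter> (A \<times> A)) \<le> square.prob Id"
      by (rule square.finite_measure_mono) (use Id_sets[OF sets_M] Inter_near in auto)
    ultimately have "prob A * prob A = 0" using diag zero_le_square[of "prob A"] by linarith
    then show False using pos by (simp add: emeasure_eq_measure)
  qed
qed




end

text \<open>Cauchy--Schwarz: a partition into \<open>N\<close> pieces leaves mass at least \<open>1/N\<close> on the squares of
  the pieces.\<close>

lemma sum_squares_ge_inverse_card:
  fixes a :: "'i \<Rightarrow> real"
  assumes "(\<Sum>i\<in>I. a i) = 1"
  shows "1 / card I \<le> (\<Sum>i\<in>I. a i * a i)"
proof -
  have "finite I" using assms by (metis sum.infinite zero_neq_one)
  moreover have "I \<noteq> {}" using assms by auto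
  ultimately have "0 < real (card I)" by (simp add: card_gt_0_iff)
  then show ?thesis
    using sum_squared_le_sum_of_squares[of a I] assms by (simp add: divide_le_eq power2_eq_square)
qed

lemma (in refining_labels) vimage_cell_rectangles:
  "map_prod T T -` cell_rectangles k J = (\<Union>p\<in>J. (T -` cell k (fst p)) \<times> (T -` cell k (snd p)))"
  unfolding cell_rectangles_def by fastforce

lemma (in refining_labels) disjoint_family_rectangles:
  "disjoint_family_on (\<lambda>p. (T -` cell k (fst p)) \<times> (T -` cell k (snd p))) J"
  unfolding disjoint_family_on_def by (auto simp: prod_eq_iff)

lemma (in label_measure) prob_vimage_cell_rectangles:
  assumes "finite J" "\<And>j. T -` cell k j \<in> sets M"
  shows "square.prob (map_prod T T -` cell_rectangles k J) =
    (\<Sum>p\<in>J. prob (T -` cell k (fst p)) * prob (T -` cell k (snd p)))"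
  unfolding vimage_cell_rectangles
  by (rule prob_Union_rectangles) (use assms disjoint_family_rectangles in auto)

lemma (in label_measure) prob_near_vimage:
  assumes "\<And>j. T -` cell k j \<in> sets M"
  shows "square.prob (map_prod T T -` near k) = (\<Sum>j\<in>range (c k). prob (T -` cell k j) * prob (T -` cell k j))"
  unfolding near_def
  by (subst prob_vimage_cell_rectangles) (auto simp: assms finite_labels sum.reindex inj_on_def)

lemma (in label_measure) prob_near:
  "square.prob (near k) = (\<Sum>j\<in>range (c k). prob (cell k j) * prob (cell k j))"
  using prob_near_vimage[of id k] label_sets_M by (simp add: map_prod.id)

lemma (in label_measure) prob_near_vimage_lower_bound:
  assumes "\<And>j. T -` cell k j \<in> sets M"
  shows "1 / card (range (c k)) \<le> square.prob (map_prod T T -` near k)"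
  unfolding prob_near_vimage[OF assms]
proof (rule sum_squares_ge_inverse_card)
  have "(\<Sum>j\<in>range (c k). prob (T -` cell k j)) = prob (\<Union>j\<in>range (c k). T -` cell k j)"
    by (rule finite_measure_finite_Union[symmetric])
      (use assms finite_labels in \<open>auto simp: disjoint_family_on_def\<close>)
  also have "(\<Union>j\<in>range (c k). T -` cell k j) = space M" by (auto simp: space_M)
  finally show "(\<Sum>j\<in>range (c k). prob (T -` cell k j)) = 1" by (simp add: prob_space)
qed

lemma (in label_measure) mixing_vimage_cell_rectangles:
  assumes "finite J" "\<And>j. mixing_events M (\<lambda>n. T n -` cell k j)"
  shows "mixing_events (M \<Otimes>\<^sub>M M) (\<lambda>n. map_prod (T n) (T n) -` cell_rectangles k J)"
  unfolding vimage_cell_rectangles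
proof (rule square.mixing_events_disjoint_UN[OF assms(1)])
  show "mixing_events (M \<Otimes>\<^sub>M M) (\<lambda>i. (T i -` cell k (fst p)) \<times> (T i -` cell k (snd p)))" for p
    by (rule mixing_events_times[OF prob_space_axioms prob_space_axioms assms(2) assms(2)])
  show "disjoint_family_on (\<lambda>p. (T i -` cell k (fst p)) \<times> (T i -` cell k (snd p))) J" for i
    by (rule disjoint_family_rectangles)
qed

text \<open>The diagonal is covered by the squares over the joint partition into the sets
  \<open>cell k q \<inter> T -` cell k p\<close>.  If the two partitions are nearly independent, i.e. if \<open>d\<close> is small, the
  total mass of these squares is nearly the product of the masses of the squares over the two
  partitions separately.\<close>

lemma (in label_measure) prob_diagonal_le:
  assumes T: "\<And>j. T -` cell k j \<in> sets M"
  defines "d \<equiv> \<lambda>p q. prob (cell k q \<inter> T -` cell k p) - prob (cell k q) * prob (T -` cell k p)"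
  shows "square.prob Id \<le> square.prob (near k) * square.prob (map_prod T T -` near k) +
    2 * (\<Sum>p\<in>range (c k). \<Sum>q\<in>range (c k). \<bar>d p q\<bar>)"
proof -
  let ?J = "range (c k) \<times> range (c k)"
  let ?A = "\<lambda>(p, q). cell k q \<inter> T -` cell k p"
  have A: "?A p \<in> sets M" for p using T label_sets_M by (auto split: prod.split)
  have fin: "finite ?J" using finite_labels by simp
  have U: "(\<Union>p\<in>?J. ?A p \<times> ?A p) \<in> sets (M \<Otimes>\<^sub>M M)"
    using A fin by (intro sets.finite_UN pair_measureI) auto
  have "square.prob Id \<le> square.prob (\<Union>p\<in>?J. ?A p \<times> ?A p)"
    by (rule square.finite_measure_mono[OF _ U]) auto
  also have "\<dots> = (\<Sum>p\<in>?J. prob (?A p) * prob (?A p))"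
    by (rule prob_Union_rectangles[OF fin A A]) (auto simp: disjoint_family_on_def)
  also have "\<dots> \<le> (\<Sum>(p, q)\<in>?J. (prob (T -` cell k p) * prob (T -` cell k p)) * (prob (cell k q) * prob (cell k q))
      + 2 * \<bar>d p q\<bar>)"
  proof (rule sum_mono, clarify)
    fix x x'
    let ?p = "c k x" and ?q = "c k x'"
    define a z where "a = prob (cell k ?q \<inter> T -` cell k ?p)" and "z = prob (cell k ?q) * prob (T -` cell k ?p)"
    have "0 \<le> a" "a \<le> 1" "0 \<le> z" "z \<le> 1" unfolding a_def z_def by (auto intro: mult_le_one)
    then have "(a - z) * (a + z) \<le> \<bar>a - z\<bar> * 2"
      by (intro mult_mono) auto
    then have "a * a \<le> z * z + 2 * \<bar>a - z\<bar>" by (simp add: algebra_simps)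
    then show "prob (cell k ?q \<inter> T -` cell k ?p) * prob (cell k ?q \<inter> T -` cell k ?p)
      \<le> (prob (T -` cell k ?p) * prob (T -` cell k ?p)) * (prob (cell k ?q) * prob (cell k ?q)) + 2 * \<bar>d ?p ?q\<bar>"
      unfolding d_def a_def z_def by (simp add: mult_ac)
  qed
  also have "\<dots> = (\<Sum>(p, q)\<in>?J. (prob (T -` cell k p) * prob (T -` cell k p)) * (prob (cell k q) * prob (cell k q)))
      + 2 * (\<Sum>(p, q)\<in>?J. \<bar>d p q\<bar>)"
    by (simp add: sum.distrib sum_distrib_left split_beta)
  also have "(\<Sum>(p, q)\<in>?J. (prob (T -` cell k p) * prob (T -` cell k p)) * (prob (cell k q) * prob (cell k q)))
      = square.prob (near k) * square.prob (map_prod T T -` near k)"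
    unfolding prob_near prob_near_vimage[OF T] sum.cartesian_product[symmetric]
    by (simp add: sum_product mult.commute) (rule sum.swap)
  also have "(\<Sum>(p, q)\<in>?J. \<bar>d p q\<bar>) = (\<Sum>p\<in>range (c k). \<Sum>q\<in>range (c k). \<bar>d p q\<bar>)"
    by (rule sum.cartesian_product[symmetric])
  finally show ?thesis .
qed

section \<open>Relatively mixing extensions\<close>

lemma (in prob_space) expectation_abs_le_L2:
  fixes f :: "'a \<Rightarrow> real"
  assumes "f \<in> borel_measurable M" and bound: "\<And>x. x \<in> space M \<Longrightarrow> \<bar>f x\<bar> \<le> C"
  shows "expectation (\<lambda>x. \<bar>f x\<bar>) \<le> sqrt (expectation (\<lambda>x. (f x)\<^sup>2))"
proof -
  have "integrable M (\<lambda>x. \<bar>f x\<bar>)"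
    by (rule integrable_const_bound[of _ C]) (use assms in auto)
  moreover have "integrable M (\<lambda>x. \<bar>f x\<bar>\<^sup>2)"
  proof (rule integrable_const_bound[of _ "C\<^sup>2"])
    show "AE x in M. norm (\<bar>f x\<bar>\<^sup>2) \<le> C\<^sup>2"
    proof (rule AE_I2)
      fix x assume "x \<in> space M"
      from power_mono[OF bound[OF this], of 2] show "norm (\<bar>f x\<bar>\<^sup>2) \<le> C\<^sup>2" by simp
    qed
  qed (use assms in auto)
  ultimately have "0 \<le> expectation (\<lambda>x. \<bar>f x\<bar>\<^sup>2) - (expectation (\<lambda>x. \<bar>f x\<bar>))\<^sup>2"
    using variance_positive[of "\<lambda>x. \<bar>f x\<bar>"] variance_eq[of "\<lambda>x. \<bar>f x\<bar>"] by simp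
  then show ?thesis by (intro real_le_rsqrt) simp
qed

text \<open>The labels \<open>c\<close> are part of the locale because every argument about fibre measures is carried out on
  the countably many cells, for which \<open>\<nu>\<close>-null sets of exceptional \<open>y\<close> can be discarded.\<close>

locale relatively_mixing_extension = refining_labels c
  for c :: "nat \<Rightarrow> 'x :: metric_space \<Rightarrow> nat" +
  fixes G :: "('g, 'r) monoid_scheme" (structure)
    and \<alpha> :: "'g \<Rightarrow> 'x \<Rightarrow> 'x"
    and \<mu> :: "'x measure"
    and \<beta> :: "'g \<Rightarrow> 'y \<Rightarrow> 'y"
    and \<nu> :: "'y measure"
    and \<pi> :: "'x \<Rightarrow> 'y"
    and K :: "'y \<Rightarrow> 'x measure"
  assumes group_G: "group G" and countable_G: "countable (carrier G)" and infinite_G: "infinite (carrier G)"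
    and sets_\<mu>: "sets \<mu> = sets borel"
    and prob_\<nu>: "prob_space \<nu>"
    and action_\<mu>: "mp_action G \<mu> \<alpha>"
    and action_\<nu>: "mp_action G \<nu> \<beta>"
    and factor: "factor_map G \<mu> \<alpha> \<nu> \<beta> \<pi>"
    and disint: "disintegration \<mu> \<nu> \<pi> K"
    and mixing: "relatively_mixing G \<mu> \<alpha> \<nu> K"
begin

sublocale base: prob_space \<nu> by (rule prob_\<nu>)

lemma space_\<mu>: "space \<mu> = UNIV"
  using sets_eq_imp_space_eq[OF sets_\<mu>] by simp

lemma \<alpha>_measurable: "g \<in> carrier G \<Longrightarrow> \<alpha> g \<in> measurable \<mu> \<mu>"
  and \<alpha>_distr: "g \<in> carrier G \<Longrightarrow> distr \<mu> \<mu> (\<alpha> g) = \<mu>"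
  and \<beta>_measurable: "g \<in> carrier G \<Longrightarrow> \<beta> g \<in> measurable \<nu> \<nu>"
  and \<beta>_distr: "g \<in> carrier G \<Longrightarrow> distr \<nu> \<nu> (\<beta> g) = \<nu>"
  using action_\<mu> action_\<nu> unfolding mp_action_def by auto

lemma \<pi>_measurable: "\<pi> \<in> measurable \<mu> \<nu>"
  and \<pi>_equivariant: "g \<in> carrier G \<Longrightarrow> AE x in \<mu>. \<pi> (\<alpha> g x) = \<beta> g (\<pi> x)"
  using factor unfolding factor_map_def by auto

lemma vimage_\<alpha>_sets: "g \<in> carrier G \<Longrightarrow> A \<in> sets borel \<Longrightarrow> \<alpha> g -` A \<in> sets borel"
  using measurable_sets[OF \<alpha>_measurable, of g A] by (simp add: sets_\<mu> space_\<mu>)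

lemma K_measurable: "K \<in> measurable \<nu> (prob_algebra \<mu>)"
  and K_fibre: "AE y in \<nu>. AE x in K y. \<pi> x = y"
  and emeasure_\<mu>: "A \<in> sets borel \<Longrightarrow> emeasure \<mu> A = (\<integral>\<^sup>+ y. emeasure (K y) A \<partial>\<nu>)"
  using disint sets_\<mu> unfolding disintegration_def by auto

lemma label_measure_K: "y \<in> space \<nu> \<Longrightarrow> label_measure c (K y)"
  using measurable_space[OF K_measurable, of y] sets_\<mu> refining_labels_axioms
  by (auto simp: space_prob_algebra label_measure_def label_measure_axioms_def)

lemma measure_K_measurable: "A \<in> sets borel \<Longrightarrow> (\<lambda>y. measure (K y) A) \<in> borel_measurable \<nu>"
  using measurable_compose[OF K_measurable measurable_measure_prob_algebra[of A \<mu>]] sets_\<mu> by simp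

lemma emeasure_K_measurable: "A \<in> sets borel \<Longrightarrow> (\<lambda>y. emeasure (K y) A) \<in> borel_measurable \<nu>"
  using measurable_compose[OF measurable_prob_algebraD[OF K_measurable] measurable_emeasure_subprob_algebra[of A \<mu>]]
    sets_\<mu> by simp

lemma measure_square_measurable:
  assumes "A \<in> sets (\<mu> \<Otimes>\<^sub>M \<mu>)"
  shows "(\<lambda>y. measure (K y \<Otimes>\<^sub>M K y) A) \<in> borel_measurable \<nu>"
  using measurable_compose[OF measurable_pair_prob[OF K_measurable K_measurable] measurable_measure_prob_algebra[OF assms]] .

lemma AE_fibres:
  assumes "AE x in \<mu>. P x"
  shows "AE y in \<nu>. AE x in K y. P x"
proof -
  from assms obtain N where N: "{x \<in> space \<mu>. \<not> P x} \<subseteq> N" "emeasure \<mu> N = 0" "N \<in> sets \<mu>"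
    by (rule AE_E)
  have Nb: "N \<in> sets borel" using N(3) sets_\<mu> by simp
  have "AE y in \<nu>. emeasure (K y) N = 0"
    using emeasure_\<mu>[OF Nb] N(2) nn_integral_0_iff_AE[OF emeasure_K_measurable[OF Nb]] by simp
  with AE_space show ?thesis
  proof eventually_elim
    case (elim y)
    interpret label_measure c "K y" using label_measure_K elim(1) .
    have "N \<in> null_sets (K y)" using elim(2) Nb sets_M by auto
    then show ?case using N(1) space_\<mu> by (intro AE_I') auto
  qed
qed

lemma emeasure_over_base:
  assumes A: "A \<in> sets borel" and B: "B \<in> sets \<nu>"
  shows "emeasure \<mu> (A \<inter> \<pi> -` B) = (\<integral>\<^sup>+ y. emeasure (K y) A * indicator B y \<partial>\<nu>)"
proof -
  have piB: "\<pi> -` B \<in> sets borel"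
    using measurable_sets[OF \<pi>_measurable B] by (simp add: sets_\<mu> space_\<mu>)
  have "emeasure \<mu> (A \<inter> \<pi> -` B) = (\<integral>\<^sup>+ y. emeasure (K y) (A \<inter> \<pi> -` B) \<partial>\<nu>)"
    using A piB by (intro emeasure_\<mu>) auto
  also have "\<dots> = (\<integral>\<^sup>+ y. emeasure (K y) A * indicator B y \<partial>\<nu>)"
  proof (rule nn_integral_cong_AE)
    show "AE y in \<nu>. emeasure (K y) (A \<inter> \<pi> -` B) = emeasure (K y) A * indicator B y"
      using K_fibre AE_space
    proof eventually_elim
      case (elim y)
      interpret label_measure c "K y" using label_measure_K elim(2) .
      show ?case
      proof (cases "y \<in> B")
        case True
        have "emeasure (K y) (A \<inter> \<pi> -` B) = emeasure (K y) A"
          by (rule emeasure_eq_AE) (use elim(1) True A piB sets_M in \<open>auto elim: eventually_mono\<close>)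
        then show ?thesis using True by simp
      next
        case False
        have "emeasure (K y) (A \<inter> \<pi> -` B) = emeasure (K y) {}"
          by (rule emeasure_eq_AE) (use elim(1) False A piB sets_M in \<open>auto elim: eventually_mono\<close>)
        then show ?thesis using False by simp
      qed
    qed
  qed
  finally show ?thesis .
qed

lemma \<beta>_space: "g \<in> carrier G \<Longrightarrow> y \<in> space \<nu> \<Longrightarrow> \<beta> g y \<in> space \<nu>"
  using \<beta>_measurable by (rule measurable_space)

lemma \<beta>_inverse: "g \<in> carrier G \<Longrightarrow> y \<in> space \<nu> \<Longrightarrow> \<beta> (inv g) (\<beta> g y) = y"
  using action_\<nu> group_action.orbit_sym_aux[of G "space \<nu>" \<beta> g y] unfolding mp_action_def by blast

text \<open>Uniqueness of disintegrations: over every measurable set of the base, both sides integrate to the same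
  value because \<open>\<alpha> g\<close> preserves \<open>\<mu>\<close> and \<open>\<beta> g\<close> preserves \<open>\<nu>\<close>.\<close>

lemma measure_K_equivariant:
  assumes g: "g \<in> carrier G" and A: "A \<in> sets borel"
  shows "AE y in \<nu>. measure (K (\<beta> g y)) A = measure (K y) (\<alpha> g -` A)"
proof -
  note gA = vimage_\<alpha>_sets[OF g A]
  have inv: "inv g \<in> carrier G" using group.inv_closed[OF group_G g] .
  have "AE y in \<nu>. emeasure (K (\<beta> g y)) A = emeasure (K y) (\<alpha> g -` A)"
  proof (rule base.density_unique_finite_measure)
    show m: "(\<lambda>y. emeasure (K (\<beta> g y)) A) \<in> borel_measurable \<nu>"
      using measurable_compose[OF \<beta>_measurable[OF g] emeasure_K_measurable[OF A]] .
    show "(\<lambda>y. emeasure (K y) (\<alpha> g -` A)) \<in> borel_measurable \<nu>" by (rule emeasure_K_measurable[OF gA])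
    fix B assume B: "B \<in> sets \<nu>"
    define B' where "B' = \<beta> (inv g) -` B \<inter> space \<nu>"
    have B': "B' \<in> sets \<nu>" unfolding B'_def using measurable_sets[OF \<beta>_measurable[OF inv] B] .
    have BB': "\<beta> g y \<in> B' \<longleftrightarrow> y \<in> B" if "y \<in> space \<nu>" for y
      unfolding B'_def using \<beta>_space[OF g that] \<beta>_inverse[OF g that] by simp
    have piB': "\<pi> -` B' \<in> sets borel" and piB: "\<pi> -` B \<in> sets borel"
      using measurable_sets[OF \<pi>_measurable B'] measurable_sets[OF \<pi>_measurable B] by (simp_all add: sets_\<mu> space_\<mu>)
    have "(\<integral>\<^sup>+ y. emeasure (K (\<beta> g y)) A * indicator B y \<partial>\<nu>) =
        (\<integral>\<^sup>+ y. emeasure (K (\<beta> g y)) A * indicator B' (\<beta> g y) \<partial>\<nu>)"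
      by (rule nn_integral_cong) (auto simp: BB' indicator_def)
    also have "\<dots> = (\<integral>\<^sup>+ z. emeasure (K z) A * indicator B' z \<partial>distr \<nu> \<nu> (\<beta> g))"
      by (rule nn_integral_distr[symmetric, OF \<beta>_measurable[OF g]])
        (use emeasure_K_measurable[OF A] B' in measurable)
    also have "\<dots> = emeasure \<mu> (A \<inter> \<pi> -` B')"
      unfolding \<beta>_distr[OF g] emeasure_over_base[OF A B'] ..
    also have "\<dots> = emeasure (distr \<mu> \<mu> (\<alpha> g)) (A \<inter> \<pi> -` B')" unfolding \<alpha>_distr[OF g] ..
    also have "\<dots> = emeasure \<mu> (\<alpha> g -` (A \<inter> \<pi> -` B'))"
      using emeasure_distr[OF \<alpha>_measurable[OF g], of "A \<inter> \<pi> -` B'"] A piB' sets_\<mu> space_\<mu> by simp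
    also have "\<dots> = emeasure \<mu> (\<alpha> g -` A \<inter> \<pi> -` B)"
    proof (rule emeasure_eq_AE)
      show "AE x in \<mu>. (x \<in> \<alpha> g -` (A \<inter> \<pi> -` B')) = (x \<in> \<alpha> g -` A \<inter> \<pi> -` B)"
        using \<pi>_equivariant[OF g]
      proof eventually_elim
        case (elim x)
        have "\<pi> x \<in> space \<nu>" using measurable_space[OF \<pi>_measurable] space_\<mu> by simp
        then show ?case using elim BB' by simp
      qed
      show "\<alpha> g -` (A \<inter> \<pi> -` B') \<in> sets \<mu>" using vimage_\<alpha>_sets[OF g, of "A \<inter> \<pi> -` B'"] A piB' sets_\<mu> by simp
      show "\<alpha> g -` A \<inter> \<pi> -` B \<in> sets \<mu>" using gA piB sets_\<mu> by simp
    qed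
    also have "\<dots> = (\<integral>\<^sup>+ y. emeasure (K y) (\<alpha> g -` A) * indicator B y \<partial>\<nu>)"
      by (rule emeasure_over_base[OF gA B])
    finally show "(\<integral>\<^sup>+ y. emeasure (K (\<beta> g y)) A * indicator B y \<partial>\<nu>) =
        (\<integral>\<^sup>+ y. emeasure (K y) (\<alpha> g -` A) * indicator B y \<partial>\<nu>)" .
  qed auto
  then show ?thesis by eventually_elim (simp add: measure_def)
qed

definition decorrelation :: "'g \<Rightarrow> 'x set \<Rightarrow> 'x set \<Rightarrow> 'y \<Rightarrow> real" where
  "decorrelation g A B y =
     measure (K y) (B \<inter> \<alpha> g -` A) - measure (K y) B * measure (K y) (\<alpha> g -` A)"

lemma decorrelation_measurable:
  assumes "g \<in> carrier G" "A \<in> sets borel" "B \<in> sets borel"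
  shows "decorrelation g A B \<in> borel_measurable \<nu>"
proof -
  have "\<alpha> g -` A \<in> sets borel" "B \<inter> \<alpha> g -` A \<in> sets borel" using vimage_\<alpha>_sets assms by auto
  then show ?thesis unfolding decorrelation_def using measure_K_measurable assms by measurable
qed

lemma abs_decorrelation_le_1:
  assumes "y \<in> space \<nu>"
  shows "\<bar>decorrelation g A B y\<bar> \<le> 1"
proof -
  interpret label_measure c "K y" using label_measure_K assms .
  have "0 \<le> prob B * prob (\<alpha> g -` A)" "prob B * prob (\<alpha> g -` A) \<le> 1" by (auto intro: mult_le_one)
  moreover have "0 \<le> prob (B \<inter> \<alpha> g -` A)" "prob (B \<inter> \<alpha> g -` A) \<le> 1" by auto
  ultimately show ?thesis unfolding decorrelation_def by (intro abs_leI; linarith)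
qed

lemma integrable_abs_decorrelation:
  assumes "g \<in> carrier G" "A \<in> sets borel" "B \<in> sets borel"
  shows "integrable \<nu> (\<lambda>y. \<bar>decorrelation g A B y\<bar>)"
  by (rule base.integrable_const_bound[of _ 1])
    (use abs_decorrelation_le_1 decorrelation_measurable[OF assms] in auto)

lemma tendsto_inverse_at_infinity:
  assumes "inj s" "range s \<subseteq> carrier G"
  shows "filterlim (\<lambda>i :: nat. inv (s i)) (group_at_infinity G) sequentially"
proof -
  have "inj (\<lambda>i. inv (s i))"
    using assms group.inv_inj[OF group_G] unfolding inj_on_def by (metis range_subsetD UNIV_I)
  then have "finite ((\<lambda>i. inv (s i)) -` {x. \<not> P x})" if "finite {x. \<not> P x}" for P
    using that by (intro finite_vimageI)
  then have "filterlim (\<lambda>i. inv (s i)) cofinite sequentially"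
    unfolding filterlim_iff cofinite_eq_sequentially[symmetric] eventually_cofinite by (simp add: vimage_def)
  moreover have "\<forall>i. inv (s i) \<in> carrier G" using assms(2) group.inv_closed[OF group_G] by blast
  ultimately show ?thesis
    unfolding group_at_infinity_def filterlim_inf filterlim_principal by (simp add: always_eventually)
qed

definition centred :: "'x set \<Rightarrow> 'x \<Rightarrow> real" where
  "centred A x = indicator A x - measure (K (\<pi> x)) A"

lemma centred_measurable:
  assumes "A \<in> sets borel"
  shows "centred A \<in> borel_measurable \<mu>"
  unfolding centred_def using assms sets_\<mu> measurable_compose[OF \<pi>_measurable measure_K_measurable[OF assms]]
  by (intro borel_measurable_diff) auto

lemma \<pi>_space: "\<pi> x \<in> space \<nu>"
  using measurable_space[OF \<pi>_measurable] space_\<mu> by simp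

lemma centred_Linfty:
  assumes "A \<in> sets borel"
  shows "centred A \<in> Linfty \<mu>"
proof -
  have "\<bar>centred A x\<bar> \<le> 1" for x
  proof -
    interpret label_measure c "K (\<pi> x)" using label_measure_K \<pi>_space .
    have "0 \<le> (indicator A x :: real)" "indicator A x \<le> (1 :: real)" by (auto split: split_indicator)
    then show ?thesis unfolding centred_def using prob_le_1[of A] measure_nonneg[of "K (\<pi> x)" A]
      by (intro abs_leI; linarith)
  qed
  then show ?thesis unfolding Linfty_def using centred_measurable[OF assms] by auto
qed

text \<open>On the fibre over \<open>y\<close> the conditional expectations being subtracted are constants, namely \<open>prob B\<close>
  and the value \<open>a\<close> at \<open>\<beta> g y\<close>.  The constant \<open>a\<close> cancels because the other factor has mean 0, so the
  covariance is that of the events \<open>\<alpha> g -` A\<close> and \<open>B\<close> under \<open>K y\<close>.\<close>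

lemma fibre_expectation_centred:
  assumes g: "g \<in> carrier G" and A: "A \<in> sets borel" and B: "B \<in> sets borel"
  shows "AE y in \<nu>. fibre_expectation K (\<lambda>x. centred A (\<alpha> g x) * centred B x) y = decorrelation g A B y"
  using K_fibre AE_fibres[OF \<pi>_equivariant[OF g]] AE_space
proof eventually_elim
  case (elim y)
  interpret label_measure c "K y" using label_measure_K elim(3) .
  let ?T = "\<alpha> g -` A"
  have T: "?T \<in> sets (K y)" "B \<in> sets (K y)" using vimage_\<alpha>_sets[OF g A] B sets_M by auto
  have meas: "(\<lambda>x. centred A (\<alpha> g x) * centred B x) \<in> borel_measurable (K y)"
  proof -
    have "(\<lambda>x. centred A (\<alpha> g x) * centred B x) \<in> borel_measurable \<mu>"
      using measurable_compose[OF \<alpha>_measurable[OF g] centred_measurable[OF A]] centred_measurable[OF B]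
      by (intro borel_measurable_times)
    then show ?thesis using sets_M sets_\<mu> by (simp cong: measurable_cong_sets)
  qed
  define a b where "a = measure (K (\<beta> g y)) A" and "b = prob B"
  have "(\<integral>x. centred A (\<alpha> g x) * centred B x \<partial>K y) =
      (\<integral>x. indicator (B \<inter> ?T) x - b * indicator ?T x - a * indicator B x + a * b \<partial>K y)"
  proof (rule integral_cong_AE[OF meas])
    show "(\<lambda>x. indicator (B \<inter> ?T) x - b * indicator ?T x - a * indicator B x + a * b) \<in> borel_measurable (K y)"
      using T by measurable
    show "AE x in K y. centred A (\<alpha> g x) * centred B x =
        indicator (B \<inter> ?T) x - b * indicator ?T x - a * indicator B x + a * b"
      using elim(1,2)
      by eventually_elim (auto simp: centred_def a_def b_def indicator_def algebra_simps)
  qed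
  also have "\<dots> = prob (B \<inter> ?T) - b * prob ?T - a * prob B + a * b"
    using T by (simp add: space_M prob_space[unfolded space_M] emeasure_eq_measure)
  also have "\<dots> = decorrelation g A B y" unfolding decorrelation_def b_def by simp
  finally show ?case unfolding fibre_expectation_def .
qed

lemma fibre_expectation_centred_0:
  assumes "A \<in> sets borel"
  shows "AE y in \<nu>. fibre_expectation K (centred A) y = 0"
  using K_fibre AE_space
proof eventually_elim
  case (elim y)
  interpret label_measure c "K y" using label_measure_K elim(2) .
  have A: "A \<in> sets (K y)" using assms sets_M by simp
  have meas: "centred A \<in> borel_measurable (K y)"
    using centred_measurable[OF assms] sets_M sets_\<mu> by (simp cong: measurable_cong_sets)
  have "(\<integral>x. centred A x \<partial>K y) = (\<integral>x. indicator A x - prob A \<partial>K y)"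
    by (rule integral_cong_AE[OF meas]) (use A elim(1) in \<open>auto simp: centred_def elim!: eventually_mono\<close>)
  also have "\<dots> = 0"
    using A by (simp add: space_M prob_space[unfolded space_M] emeasure_eq_measure)
  finally show ?case unfolding fibre_expectation_def .
qed

text \<open>Relative mixing, tested on centred indicators along \<open>inv (s i) \<rightarrow> \<infinity>\<close>: the Koopman operator of
  \<open>inv (s i)\<close> is composition with \<open>\<alpha> (s i)\<close>.\<close>

lemma decorrelation_tendsto_0:
  assumes s: "inj s" "range s \<subseteq> carrier G" and A: "A \<in> sets borel" and B: "B \<in> sets borel"
  shows "(\<lambda>i. \<integral>y. \<bar>decorrelation (s i) A B y\<bar> \<partial>\<nu>) \<longlonglongrightarrow> 0"
proof -
  let ?F = "\<lambda>g. fibre_expectation K (\<lambda>x. koopman G \<alpha> g (centred A) x * centred B x)"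
  have "((\<lambda>g. L2_norm_on \<nu> (?F g)) \<longlongrightarrow> 0) (group_at_infinity G)"
    using mixing centred_Linfty[OF A] centred_Linfty[OF B] fibre_expectation_centred_0[OF A] fibre_expectation_centred_0[OF B]
    unfolding relatively_mixing_def by blast
  from filterlim_compose[OF this tendsto_inverse_at_infinity[OF s]]
  have lim: "(\<lambda>i. L2_norm_on \<nu> (?F (inv (s i)))) \<longlonglongrightarrow> 0" .
  show ?thesis
  proof (rule tendsto_sandwich[OF _ _ tendsto_const lim])
    show "\<forall>\<^sub>F i in sequentially. 0 \<le> (\<integral>y. \<bar>decorrelation (s i) A B y\<bar> \<partial>\<nu>)" by simp
    have "(\<integral>y. \<bar>decorrelation (s i) A B y\<bar> \<partial>\<nu>) \<le> L2_norm_on \<nu> (?F (inv (s i)))" for i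
    proof -
      have si: "s i \<in> carrier G" using s(2) by blast
      have inv: "inv (inv (s i)) = s i" using group.inv_inv[OF group_G si] .
      have F: "?F (inv (s i)) = fibre_expectation K (\<lambda>x. centred A (\<alpha> (s i) x) * centred B x)"
        unfolding koopman_def inv ..
      have meas: "(\<lambda>x. centred A (\<alpha> (s i) x) * centred B x) \<in> borel_measurable \<mu>"
        using measurable_compose[OF \<alpha>_measurable[OF si] centred_measurable[OF A]] centred_measurable[OF B]
        by (intro borel_measurable_times)
      have "fibre_expectation K (\<lambda>x. centred A (\<alpha> (s i) x) * centred B x) \<in> borel_measurable \<nu>"
        unfolding fibre_expectation_def
        using measurable_compose[OF measurable_prob_algebraD[OF K_measurable] integral_measurable_subprob_algebra[OF meas]] .
      then have "(\<integral>y. (?F (inv (s i)) y)\<^sup>2 \<partial>\<nu>) = (\<integral>y. (decorrelation (s i) A B y)\<^sup>2 \<partial>\<nu>)"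
        unfolding F using decorrelation_measurable[OF si A B] fibre_expectation_centred[OF si A B]
        by (intro integral_cong_AE) (auto elim: eventually_mono)
      then have "L2_norm_on \<nu> (?F (inv (s i))) = sqrt (\<integral>y. (decorrelation (s i) A B y)\<^sup>2 \<partial>\<nu>)"
        unfolding L2_norm_on_def by simp
      then show ?thesis
        using base.expectation_abs_le_L2[OF decorrelation_measurable[OF si A B], of 1] abs_decorrelation_le_1 by simp
    qed
    then show "\<forall>\<^sub>F i in sequentially. (\<integral>y. \<bar>decorrelation (s i) A B y\<bar> \<partial>\<nu>) \<le> L2_norm_on \<nu> (?F (inv (s i)))"
      by simp
  qed
qed

end

section \<open>Fibre measures are nonatomic or Dirac\<close>

context relatively_mixing_extension
begin

abbreviation fibre_square :: "'y \<Rightarrow> ('x \<times> 'x) measure" where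
  "fibre_square y \<equiv> K y \<Otimes>\<^sub>M K y"

definition diagonal_mass :: "'y \<Rightarrow> real" where
  "diagonal_mass y = measure (fibre_square y) Id"

definition near_mass :: "nat \<Rightarrow> 'y \<Rightarrow> real" where
  "near_mass k y = measure (fibre_square y) (near k)"

lemma diagonal_mass_measurable: "diagonal_mass \<in> borel_measurable \<nu>"
  and near_mass_measurable: "near_mass k \<in> borel_measurable \<nu>"
  unfolding diagonal_mass_def near_mass_def
  using measure_square_measurable[OF Id_sets[OF sets_\<mu>]] measure_square_measurable[OF near_sets[OF sets_\<mu>]]
  by simp_all

lemma diagonal_mass_bounds: "y \<in> space \<nu> \<Longrightarrow> 0 \<le> diagonal_mass y \<and> diagonal_mass y \<le> 1"
  and near_mass_bounds: "y \<in> space \<nu> \<Longrightarrow> 0 \<le> near_mass k y \<and> near_mass k y \<le> 1"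
proof -
  assume "y \<in> space \<nu>"
  then interpret label_measure c "K y" by (rule label_measure_K)
  show "0 \<le> diagonal_mass y \<and> diagonal_mass y \<le> 1" "0 \<le> near_mass k y \<and> near_mass k y \<le> 1"
    unfolding diagonal_mass_def near_mass_def by auto
qed

lemma nonatomic_fibres_eq: "nonatomic_fibres \<nu> K = {y \<in> space \<nu>. diagonal_mass y = 0}"
  unfolding nonatomic_fibres_def diagonal_mass_def
  using label_measure.nonatomic_iff_diagonal_null[OF label_measure_K] by blast

lemma nonatomic_fibres_sets: "nonatomic_fibres \<nu> K \<in> sets \<nu>"
  unfolding nonatomic_fibres_eq using diagonal_mass_measurable by measurable

lemma measure_rectangles_equivariant:
  assumes g: "g \<in> carrier G" and J: "finite J"
  shows "AE y in \<nu>. measure (fibre_square (\<beta> g y)) (cell_rectangles k J) =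
    measure (fibre_square y) (map_prod (\<alpha> g) (\<alpha> g) -` cell_rectangles k J)"
proof -
  have "AE y in \<nu>. \<forall>j. measure (K (\<beta> g y)) (cell k j) = measure (K y) (\<alpha> g -` cell k j)"
    unfolding AE_all_countable using measure_K_equivariant[OF g label_sets] by blast
  with AE_space show ?thesis
  proof eventually_elim
    case (elim y)
    interpret M: label_measure c "K y" using label_measure_K elim(1) .
    interpret N: label_measure c "K (\<beta> g y)" using label_measure_K \<beta>_space[OF g] elim(1) by blast
    have "\<alpha> g -` cell k j \<in> sets (K y)" for j using vimage_\<alpha>_sets[OF g label_sets] M.sets_M by simp
    then show ?case
      using N.prob_vimage_cell_rectangles[OF J, of id k] M.prob_vimage_cell_rectangles[OF J, of "\<alpha> g" k]
        N.label_sets_M elim(2) by (simp add: map_prod.id)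
  qed
qed

lemma infinite_sequence_in_group:
  obtains s :: "nat \<Rightarrow> 'g" where "inj s" "range s \<subseteq> carrier G"
  using infinite_countable_subset[OF infinite_G] by blast

text \<open>For \<open>g = s i\<close> the bound \<open>prob_diagonal_le\<close> reads
  \<open>diagonal_mass y \<le> near_mass k y * near_mass k (\<beta> g y)\<close> up to an error that vanishes in \<open>L\<^sup>1\<close> as
  \<open>i \<rightarrow> \<infinity>\<close>.  Since \<open>\<beta> g\<close> preserves \<open>\<nu>\<close>, the inequality between geometric and arithmetic mean
  removes \<open>\<beta> g\<close> from the integral.\<close>

lemma integral_diagonal_mass_le_near:
  "(\<integral>y. diagonal_mass y \<partial>\<nu>) \<le> (\<integral>y. (near_mass k y)\<^sup>2 \<partial>\<nu>)"
proof -
  obtain s :: "nat \<Rightarrow> 'g" where s: "inj s" "range s \<subseteq> carrier G" by (rule infinite_sequence_in_group)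
  let ?L = "range (c k)"
  let ?d = "\<lambda>i p q y. \<bar>decorrelation (s i) (cell k p) (cell k q) y\<bar>"
  have le: "(\<integral>y. diagonal_mass y \<partial>\<nu>) \<le> (\<integral>y. (near_mass k y)\<^sup>2 \<partial>\<nu>) + 2 * (\<Sum>p\<in>?L. \<Sum>q\<in>?L. \<integral>y. ?d i p q y \<partial>\<nu>)" for i
  proof -
    have g: "s i \<in> carrier G" using s by blast
    have int_d: "integrable \<nu> (?d i p q)" for p q
      by (rule integrable_abs_decorrelation[OF g label_sets label_sets])
    have int_n: "integrable \<nu> (\<lambda>y. (near_mass k y)\<^sup>2)"
      by (rule base.integrable_const_bound[of _ 1])
        (use near_mass_bounds near_mass_measurable in \<open>auto intro!: AE_I2 power_le_one\<close>)
    have int_n': "integrable \<nu> (\<lambda>y. (near_mass k (\<beta> (s i) y))\<^sup>2)"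
      by (rule base.integrable_const_bound[of _ 1])
        (use near_mass_bounds[OF \<beta>_space[OF g]] measurable_compose[OF \<beta>_measurable[OF g] near_mass_measurable]
          in \<open>auto intro!: AE_I2 power_le_one\<close>)
    have eq: "(\<integral>y. (near_mass k (\<beta> (s i) y))\<^sup>2 \<partial>\<nu>) = (\<integral>y. (near_mass k y)\<^sup>2 \<partial>\<nu>)"
      using integral_distr[OF \<beta>_measurable[OF g], of "\<lambda>y. (near_mass k y)\<^sup>2"] near_mass_measurable
      unfolding \<beta>_distr[OF g] by simp
    have int_m: "integrable \<nu> diagonal_mass"
      by (rule base.integrable_const_bound[of _ 1]) (use diagonal_mass_bounds diagonal_mass_measurable in auto)
    have "(\<integral>y. diagonal_mass y \<partial>\<nu>) \<le>
        (\<integral>y. ((near_mass k y)\<^sup>2 + (near_mass k (\<beta> (s i) y))\<^sup>2) / 2 + 2 * (\<Sum>p\<in>?L. \<Sum>q\<in>?L. ?d i p q y) \<partial>\<nu>)"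
    proof (rule integral_mono_AE[OF int_m])
      show "integrable \<nu> (\<lambda>y. ((near_mass k y)\<^sup>2 + (near_mass k (\<beta> (s i) y))\<^sup>2) / 2 + 2 * (\<Sum>p\<in>?L. \<Sum>q\<in>?L. ?d i p q y))"
        using int_n int_n' int_d
        by (intro Bochner_Integration.integrable_add integrable_divide_zero integrable_mult_right Bochner_Integration.integrable_sum)
          auto
      have "finite ((\<lambda>j. (j, j)) ` ?L)" using finite_labels by simp
      from measure_rectangles_equivariant[OF g this, of k]
      show "AE y in \<nu>. diagonal_mass y \<le>
          ((near_mass k y)\<^sup>2 + (near_mass k (\<beta> (s i) y))\<^sup>2) / 2 + 2 * (\<Sum>p\<in>?L. \<Sum>q\<in>?L. ?d i p q y)"
        using AE_space
      proof eventually_elim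
        case (elim y)
        interpret label_measure c "K y" using label_measure_K elim(2) .
        have "\<alpha> (s i) -` cell k j \<in> sets (K y)" for j using vimage_\<alpha>_sets[OF g label_sets] sets_M by simp
        from prob_diagonal_le[OF this]
        have "diagonal_mass y \<le> near_mass k y * near_mass k (\<beta> (s i) y) + 2 * (\<Sum>p\<in>?L. \<Sum>q\<in>?L. ?d i p q y)"
          using elim(1) unfolding diagonal_mass_def near_mass_def decorrelation_def near_def by simp
        moreover have "near_mass k y * near_mass k (\<beta> (s i) y) \<le> ((near_mass k y)\<^sup>2 + (near_mass k (\<beta> (s i) y))\<^sup>2) / 2"
          using sum_squares_bound[of "near_mass k y" "near_mass k (\<beta> (s i) y)"] by simp
        ultimately show ?case by linarith
      qed
    qed
    also have "\<dots> = ((\<integral>y. (near_mass k y)\<^sup>2 \<partial>\<nu>) + (\<integral>y. (near_mass k (\<beta> (s i) y))\<^sup>2 \<partial>\<nu>)) / 2 +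
        2 * (\<Sum>p\<in>?L. \<Sum>q\<in>?L. \<integral>y. ?d i p q y \<partial>\<nu>)"
      using int_n int_n' int_d by (simp add: Bochner_Integration.integral_sum)
    also have "\<dots> = (\<integral>y. (near_mass k y)\<^sup>2 \<partial>\<nu>) + 2 * (\<Sum>p\<in>?L. \<Sum>q\<in>?L. \<integral>y. ?d i p q y \<partial>\<nu>)"
      unfolding eq by simp
    finally show ?thesis .
  qed
  have "(\<lambda>i. (\<integral>y. (near_mass k y)\<^sup>2 \<partial>\<nu>) + 2 * (\<Sum>p\<in>?L. \<Sum>q\<in>?L. \<integral>y. ?d i p q y \<partial>\<nu>))
      \<longlonglongrightarrow> (\<integral>y. (near_mass k y)\<^sup>2 \<partial>\<nu>) + 2 * (\<Sum>p\<in>?L. \<Sum>q\<in>?L. 0)"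
    by (intro tendsto_intros decorrelation_tendsto_0[OF s] label_sets)
  then show ?thesis using le by (intro LIMSEQ_le_const) auto
qed

text \<open>Letting \<open>k \<rightarrow> \<infinity>\<close> in the preceding bound, the integral of \<open>diagonal_mass\<close> is at most the integral of
  its square; as its values lie in \<open>[0, 1]\<close>, they are 0 or 1 almost everywhere.  Value 0 means
  nonatomic and value 1 means Dirac.\<close>

theorem diagonal_mass_zero_one: "AE y in \<nu>. diagonal_mass y = 0 \<or> diagonal_mass y = 1"
proof -
  have "(\<lambda>k. \<integral>y. (near_mass k y)\<^sup>2 \<partial>\<nu>) \<longlonglongrightarrow> (\<integral>y. (diagonal_mass y)\<^sup>2 \<partial>\<nu>)"
  proof (rule integral_dominated_convergence[where w = "\<lambda>_. 1"])
    show "AE y in \<nu>. (\<lambda>k. (near_mass k y)\<^sup>2) \<longlonglongrightarrow> (diagonal_mass y)\<^sup>2"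
      unfolding near_mass_def diagonal_mass_def
      by (intro AE_I2 tendsto_power label_measure.near_tendsto label_measure_K)
    show "AE y in \<nu>. norm ((near_mass k y)\<^sup>2) \<le> 1" for k
      using near_mass_bounds by (auto intro!: AE_I2 power_le_one)
  qed (use near_mass_measurable diagonal_mass_measurable in auto)
  then have le: "(\<integral>y. diagonal_mass y \<partial>\<nu>) \<le> (\<integral>y. (diagonal_mass y)\<^sup>2 \<partial>\<nu>)"
    using integral_diagonal_mass_le_near by (intro LIMSEQ_le_const) auto
  have int: "integrable \<nu> diagonal_mass" "integrable \<nu> (\<lambda>y. (diagonal_mass y)\<^sup>2)"
    by (rule base.integrable_const_bound[of _ 1],
        use diagonal_mass_bounds diagonal_mass_measurable in \<open>auto intro!: AE_I2 power_le_one\<close>)+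
  have nonneg: "0 \<le> diagonal_mass y - (diagonal_mass y)\<^sup>2" if "y \<in> space \<nu>" for y
    using diagonal_mass_bounds[OF that] mult_left_le[of "diagonal_mass y" "diagonal_mass y"] by (simp add: power2_eq_square)
  have "(\<integral>y. diagonal_mass y - (diagonal_mass y)\<^sup>2 \<partial>\<nu>) \<le> 0"
    using le int by simp
  moreover have "0 \<le> (\<integral>y. diagonal_mass y - (diagonal_mass y)\<^sup>2 \<partial>\<nu>)"
    using nonneg by (intro integral_nonneg_AE AE_I2) auto
  ultimately have "AE y in \<nu>. diagonal_mass y - (diagonal_mass y)\<^sup>2 = 0"
    using integral_nonneg_eq_0_iff_AE[of \<nu> "\<lambda>y. diagonal_mass y - (diagonal_mass y)\<^sup>2"] int nonneg by auto
  then show ?thesis by eventually_elim (auto simp: power2_eq_square)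
qed

end

section \<open>Dirac fibre measures and isomorphism\<close>

context relatively_mixing_extension
begin

lemma \<alpha>_compose: "g \<in> carrier G \<Longrightarrow> h \<in> carrier G \<Longrightarrow> \<alpha> g (\<alpha> h x) = \<alpha> (g \<otimes> h) x"
  and \<alpha>_one: "\<alpha> \<one> x = x"
proof -
  interpret group_action G UNIV \<alpha> using action_\<mu> unfolding mp_action_def space_\<mu> by simp
  show "g \<in> carrier G \<Longrightarrow> h \<in> carrier G \<Longrightarrow> \<alpha> g (\<alpha> h x) = \<alpha> (g \<otimes> h) x"
    by (simp add: composition_rule)
  show "\<alpha> \<one> x = x" using id_eq_one by (metis UNIV_I restrict_apply)
qed

text \<open>If almost every fibre measure is a Dirac measure, the point \<open>\<sigma> y\<close> carrying it depends
  measurably on \<open>y\<close>, because \<open>\<sigma> y \<in> A\<close> iff \<open>K y\<close> gives \<open>A\<close> full mass; so \<open>\<sigma>\<close> is a measurable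
  inverse of \<open>\<pi>\<close>.  An invariant domain is obtained by discarding the orbits that meet one of the
  countably many exceptional null sets.\<close>

theorem Dirac_fibres_imp_isomorphism:
  assumes Dirac: "AE y in \<nu>. diagonal_mass y = 1"
  shows "system_isomorphism G \<mu> \<alpha> \<nu> \<beta> \<pi>"
proof -
  have "AE y in \<nu>. diagonal_mass y = 1 \<and> (AE x in K y. \<pi> x = y)"
    using Dirac K_fibre by eventually_elim simp
  then obtain N where N: "{y \<in> space \<nu>. \<not> (diagonal_mass y = 1 \<and> (AE x in K y. \<pi> x = y))} \<subseteq> N"
    "emeasure \<nu> N = 0" "N \<in> sets \<nu>" by (rule AE_E)
  define Y1 where "Y1 = space \<nu> - N"
  have Y1: "Y1 \<in> sets \<nu>" "Y1 \<subseteq> space \<nu>" and AE_Y1: "AE y in \<nu>. y \<in> Y1"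
    using N(2,3) unfolding Y1_def by (auto intro: AE_I[of _ _ N])
  have Y1_D: "diagonal_mass y = 1" "AE x in K y. \<pi> x = y" "label_measure c (K y)" if "y \<in> Y1" for y
    using that N(1) label_measure_K unfolding Y1_def by auto
  define \<sigma> where "\<sigma> y = (SOME x. measure (K y) {x} = 1)" for y
  have \<sigma>: "measure (K y) {\<sigma> y} = 1" if "y \<in> Y1" for y
  proof -
    interpret label_measure c "K y" using Y1_D(3)[OF that] .
    show ?thesis unfolding \<sigma>_def
      using someI_ex[OF diagonal_eq_1_imp_Dirac] Y1_D(1)[OF that] unfolding diagonal_mass_def by blast
  qed
  have \<sigma>_AE: "AE x in K y. x = \<sigma> y" if "y \<in> Y1" for y
  proof -
    interpret label_measure c "K y" using Y1_D(3)[OF that] .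
    show ?thesis using AE_in_set_eq_1[OF singleton_sets_M[of "\<sigma> y"]] \<sigma>[OF that] by simp
  qed
  have \<pi>_\<sigma>: "\<pi> (\<sigma> y) = y" if "y \<in> Y1" for y
  proof -
    interpret label_measure c "K y" using Y1_D(3)[OF that] .
    have "AE x in K y. x = \<sigma> y \<and> \<pi> x = y" using \<sigma>_AE[OF that] Y1_D(2)[OF that] by eventually_elim simp
    then have "\<exists>x. x = \<sigma> y \<and> \<pi> x = y" using eventually_happens'[OF ae_filter_bot] by blast
    then show ?thesis by blast
  qed
  have \<sigma>_iff: "\<sigma> y \<in> A \<longleftrightarrow> measure (K y) A = 1" if "y \<in> Y1" "A \<in> sets borel" for y A
  proof -
    interpret label_measure c "K y" using Y1_D(3)[OF that(1)] .
    have A: "A \<in> sets (K y)" using that(2) sets_M by simp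
    have "prob A = 1 \<longleftrightarrow> (AE x in K y. x \<in> A)" using AE_in_set_eq_1[OF A] by simp
    also have "\<dots> \<longleftrightarrow> (AE x in K y. \<sigma> y \<in> A)"
      using \<sigma>_AE[OF that(1)] by (intro eventually_subst) (auto elim: eventually_mono)
    also have "\<dots> \<longleftrightarrow> \<sigma> y \<in> A"
      using eventually_happens'[OF ae_filter_bot] by auto
    finally show ?thesis by simp
  qed
  have \<sigma>_vimage: "{y \<in> Y1. \<sigma> y \<in> A} \<in> sets \<nu>" if "A \<in> sets borel" for A
  proof -
    have "{y \<in> Y1. \<sigma> y \<in> A} = Y1 \<inter> {y \<in> space \<nu>. measure (K y) A = 1}"
      using \<sigma>_iff[OF _ that] Y1(2) by auto
    moreover have "{y \<in> space \<nu>. measure (K y) A = 1} \<in> sets \<nu>"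
      using measure_K_measurable[OF that] by measurable
    ultimately show ?thesis using Y1(1) by simp
  qed
  have \<pi>_vimage: "\<pi> -` B \<in> sets borel" if "B \<in> sets \<nu>" for B
    using measurable_sets[OF \<pi>_measurable that] by (simp add: sets_\<mu> space_\<mu>)
  \<comment> \<open>Points are equal iff all their labels agree, so \<open>X1\<close> is a countable Boolean combination of
    preimages of cells.\<close>
  define X1 where "X1 = {x. \<pi> x \<in> Y1 \<and> \<sigma> (\<pi> x) = x}"
  have X1: "X1 \<in> sets borel"
  proof -
    have U: "(\<Union>j\<in>range (c k). cell k j \<inter> \<pi> -` {y \<in> Y1. \<sigma> y \<in> cell k j}) \<in> sets borel" for k
      by (intro sets.finite_UN finite_labels sets.Int label_sets \<pi>_vimage \<sigma>_vimage)
    have "X1 = (\<Inter>k. \<Union>j\<in>range (c k). cell k j \<inter> \<pi> -` {y \<in> Y1. \<sigma> y \<in> cell k j})"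
    proof (intro equalityI subsetI)
      fix x assume "x \<in> (\<Inter>k. \<Union>j\<in>range (c k). cell k j \<inter> \<pi> -` {y \<in> Y1. \<sigma> y \<in> cell k j})"
      then have *: "\<pi> x \<in> Y1" "c k (\<sigma> (\<pi> x)) = c k x" for k
        by (auto dest!: spec[of _ k])
      then have "(\<sigma> (\<pi> x), x) \<in> (\<Inter>k. near k)" by (simp add: mem_near)
      then show "x \<in> X1" using * Inter_near unfolding X1_def by blast
    qed (auto simp: X1_def)
    also have "\<dots> \<in> sets borel"
      by (intro sets.countable_INT image_subsetI U UNIV_not_empty)
    finally show ?thesis .
  qed
  have AE_X1: "AE x in \<mu>. x \<in> X1"
  proof -
    have "AE y in \<nu>. emeasure (K y) (- X1) = 0"
      using AE_Y1
    proof eventually_elim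
      case (elim y)
      interpret label_measure c "K y" using Y1_D(3)[OF elim] .
      have "\<sigma> y \<in> X1" using elim \<pi>_\<sigma>[OF elim] unfolding X1_def by simp
      then have "prob X1 = 1" using \<sigma>_iff[OF elim X1] by simp
      then show ?case using prob_compl[of X1] X1 sets_M space_M by (simp add: Compl_eq_Diff_UNIV emeasure_eq_measure)
    qed
    then have "emeasure \<mu> (- X1) = 0"
      using emeasure_\<mu>[of "- X1"] X1 by (simp cong: nn_integral_cong_AE)
    then show ?thesis using X1 sets_\<mu> by (intro AE_I[of _ _ "- X1"]) auto
  qed
  have "\<exists>E. E \<in> null_sets \<mu> \<and> {x. \<pi> (\<alpha> g x) \<noteq> \<beta> g (\<pi> x)} \<subseteq> E" if "g \<in> carrier G" for g
    using \<pi>_equivariant[OF that] by (auto elim!: AE_E simp: space_\<mu> null_sets_def)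
  then obtain E where E: "\<And>g. g \<in> carrier G \<Longrightarrow> E g \<in> null_sets \<mu>"
    "\<And>g. g \<in> carrier G \<Longrightarrow> {x. \<pi> (\<alpha> g x) \<noteq> \<beta> g (\<pi> x)} \<subseteq> E g" by metis
  define H where "H = X1 - (\<Union>g\<in>carrier G. E g)"
  have H: "H \<in> sets borel"
  proof -
    have "(\<Union>g\<in>carrier G. E g) \<in> sets \<mu>" using E(1) countable_G by (intro sets.countable_UN') auto
    then show ?thesis unfolding H_def using X1 sets_\<mu> by simp
  qed
  have AE_H: "AE x in \<mu>. x \<in> H"
  proof -
    have "(\<Union>g\<in>carrier G. E g) \<in> null_sets \<mu>" using E(1) countable_G by (intro null_sets_UN') auto
    from AE_not_in[OF this] AE_X1 show ?thesis unfolding H_def by eventually_elim auto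
  qed
  define X0 where "X0 = (\<Inter>g\<in>carrier G. \<alpha> g -` H)"
  have carrier_ne: "carrier G \<noteq> {}" using infinite_G by auto
  have X0: "X0 \<in> sets borel"
    unfolding X0_def using countable_G carrier_ne H vimage_\<alpha>_sets by (intro sets.countable_INT'') auto
  have AE_X0: "AE x in \<mu>. x \<in> X0"
  proof -
    have "AE x in \<mu>. \<alpha> g x \<in> H" if "g \<in> carrier G" for g
    proof -
      have "AE x in distr \<mu> \<mu> (\<alpha> g). x \<in> H" unfolding \<alpha>_distr[OF that] by (rule AE_H)
      then show ?thesis
        using AE_distr_iff[OF \<alpha>_measurable[OF that], of "\<lambda>x. x \<in> H"] H sets_\<mu> by simp
    qed
    then have "AE x in \<mu>. \<forall>g\<in>carrier G. \<alpha> g x \<in> H" using countable_G by (simp add: AE_ball_countable)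
    then show ?thesis unfolding X0_def by eventually_elim auto
  qed
  interpret group G by (rule group_G)
  have X0_H: "x \<in> H" if "x \<in> X0" for x
    using that \<alpha>_one[of x] unfolding X0_def by auto (metis one_closed)
  then have X0_D: "\<pi> x \<in> Y1" "\<sigma> (\<pi> x) = x" "g \<in> carrier G \<Longrightarrow> \<pi> (\<alpha> g x) = \<beta> g (\<pi> x)" if "x \<in> X0" for x g
    using that E(2) unfolding H_def X1_def by blast+
  have \<alpha>_X0: "\<alpha> g x \<in> X0" if "g \<in> carrier G" "x \<in> X0" for g x
    using that unfolding X0_def by (auto simp: \<alpha>_compose)
  have \<alpha>_image: "\<alpha> g ` X0 = X0" if g: "g \<in> carrier G" for g
  proof (intro equalityI subsetI)
    fix x assume "x \<in> X0"
    then have "\<alpha> (inv g) x \<in> X0" using \<alpha>_X0 g by blast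
    moreover have "x = \<alpha> g (\<alpha> (inv g) x)" using g by (simp add: \<alpha>_compose \<alpha>_one)
    ultimately show "x \<in> \<alpha> g ` X0" by blast
  qed (use \<alpha>_X0 g in auto)
  define Y0 where "Y0 = \<pi> ` X0"
  have Y0_eq: "Y0 = {y \<in> Y1. \<sigma> y \<in> X0}"
    unfolding Y0_def using X0_D(1,2) \<pi>_\<sigma> by force
  have Y0: "Y0 \<in> sets \<nu>" unfolding Y0_eq by (rule \<sigma>_vimage[OF X0])
  have AE_Y0: "AE y in \<nu>. y \<in> Y0"
    using AE_Y1 AE_fibres[OF AE_X0]
  proof eventually_elim
    case (elim y)
    interpret label_measure c "K y" using Y1_D(3)[OF elim(1)] .
    have "prob X0 = 1" using elim(2) AE_in_set_eq_1[of X0] X0 sets_M by simp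
    then show ?case unfolding Y0_eq using elim(1) \<sigma>_iff[OF elim(1) X0] by simp
  qed
  have \<beta>_image: "\<beta> g ` Y0 = Y0" if g: "g \<in> carrier G" for g
  proof -
    have "\<beta> g ` Y0 = \<pi> ` \<alpha> g ` X0" unfolding Y0_def image_image using X0_D(3)[OF _ g] by (intro image_cong) auto
    then show ?thesis unfolding \<alpha>_image[OF g] Y0_def .
  qed
  have inj: "inj_on \<pi> X0" using X0_D(2) by (metis inj_onI)
  then have bij: "bij_betw \<pi> X0 Y0" unfolding Y0_def bij_betw_def by simp
  have inv_eq: "the_inv_into X0 \<pi> y = \<sigma> y" if "y \<in> Y0" for y
    using that by (intro the_inv_into_f_eq[OF inj]) (auto simp: Y0_eq \<pi>_\<sigma>)
  have inv_meas: "the_inv_into X0 \<pi> \<in> measurable (restrict_space \<nu> Y0) (restrict_space \<mu> X0)"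
  proof (rule measurable_restrict_space2)
    have sp: "space (restrict_space \<nu> Y0) = Y0" using Y0 sets.sets_into_space[OF Y0] by (auto simp: space_restrict_space)
    show "the_inv_into X0 \<pi> \<in> space (restrict_space \<nu> Y0) \<rightarrow> X0"
      unfolding sp by (auto simp: inv_eq Y0_eq)
    show "the_inv_into X0 \<pi> \<in> measurable (restrict_space \<nu> Y0) \<mu>"
    proof (rule measurableI)
      fix A assume A: "A \<in> sets \<mu>"
      have "the_inv_into X0 \<pi> -` A \<inter> Y0 = {y \<in> Y1. \<sigma> y \<in> A} \<inter> Y0"
        using inv_eq by (auto simp: Y0_eq)
      also have "\<dots> \<in> sets \<nu>" using \<sigma>_vimage[of A] A sets_\<mu> Y0 by simp
      finally show "the_inv_into X0 \<pi> -` A \<inter> space (restrict_space \<nu> Y0) \<in> sets (restrict_space \<nu> Y0)"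
        unfolding sp using Y0 by (simp add: sets_restrict_space_iff)
    qed (simp add: space_\<mu>)
  qed
  have "\<pi> \<in> measurable (restrict_space \<mu> X0) (restrict_space \<nu> Y0)"
    by (rule measurable_restrict_space3[OF \<pi>_measurable]) (auto simp: Y0_def)
  then show ?thesis
    unfolding system_isomorphism_def
    using X0 sets_\<mu> Y0 AE_X0 AE_Y0 \<alpha>_image \<beta>_image bij inv_meas X0_D(3)
    by (intro bexI[of _ X0] bexI[of _ Y0]) auto
qed

corollary nonatomic_fibres_pos:
  assumes "\<not> system_isomorphism G \<mu> \<alpha> \<nu> \<beta> \<pi>"
  shows "0 < emeasure \<nu> (nonatomic_fibres \<nu> K)"
proof (rule ccontr)
  assume "\<not> 0 < emeasure \<nu> (nonatomic_fibres \<nu> K)"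
  then have "nonatomic_fibres \<nu> K \<in> null_sets \<nu>"
    using nonatomic_fibres_sets not_gr_zero by blast
  from AE_not_in[OF this] diagonal_mass_zero_one AE_space
  have "AE y in \<nu>. diagonal_mass y = 1"
    unfolding nonatomic_fibres_eq by eventually_elim auto
  with assms Dirac_fibres_imp_isomorphism show False by blast
qed

end

section \<open>Scrambled sets from recurrence of pairs\<close>

lemma (in label_measure) closed_measure_supp: "closed (measure_supp M)"
proof -
  have "- measure_supp M = \<Union>{U. open U \<and> emeasure M U = 0}"
    unfolding measure_supp_def by (auto simp: zero_less_iff_neq_zero)
  then show ?thesis unfolding closed_def by auto
qed

lemma (in label_measure) AE_measure_supp: "AE x in M. x \<in> measure_supp M"
proof -
  let ?I = "{(k, j). emeasure M (cell k j) = 0}"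
  have "(\<Union>(k, j)\<in>?I. cell k j) \<in> null_sets M"
    using label_sets_M by (intro null_sets_UN') auto
  moreover have "x \<in> (\<Union>(k, j)\<in>?I. cell k j)" if x: "x \<notin> measure_supp M" for x
  proof -
    obtain U where U: "open U" "x \<in> U" "emeasure M U = 0"
      using x unfolding measure_supp_def by (auto simp: zero_less_iff_neq_zero)
    then obtain k j where kj: "x \<in> cell k j" "cell k j \<subseteq> U"
      using open_Union_cells[OF U(1)] by blast
    have "emeasure M (cell k j) \<le> emeasure M U" using kj(2) U(1) sets_M by (intro emeasure_mono) auto
    then show ?thesis using kj(1) U(3) by auto
  qed
  ultimately show ?thesis by (intro AE_I') auto
qed

lemma liminf_dist_eq_0:
  fixes f :: "nat \<Rightarrow> real"
  assumes "\<And>i. 0 \<le> f i" and "\<And>n. \<exists>i\<ge>n. f i < 1 / Suc n"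
  shows "liminf (\<lambda>i. ereal (f i)) = 0"
proof (rule antisym)
  show "0 \<le> liminf (\<lambda>i. ereal (f i))" by (rule Liminf_bounded) (simp add: assms(1))
  show "liminf (\<lambda>i. ereal (f i)) \<le> 0"
  proof (rule ccontr)
    assume "\<not> liminf (\<lambda>i. ereal (f i)) \<le> 0"
    then have "0 < liminf (\<lambda>i. ereal (f i))" by simp
    from ereal_dense2[OF this] obtain z where z: "0 < ereal z" "ereal z < liminf (\<lambda>i. ereal (f i))"
      by blast
    then have "\<forall>\<^sub>F i in sequentially. ereal z < ereal (f i)"
      by (intro less_LiminfD)
    then obtain n where n: "\<And>i. n \<le> i \<Longrightarrow> z < f i" by (auto simp: eventually_sequentially)
    have "0 < z" using z(1) by simp
    then obtain m :: nat where m: "1 / Suc m < z" using nat_approx_posE by blast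
    obtain i where i: "max n m \<le> i" "f i < 1 / Suc (max n m)" using assms(2) by blast
    have "1 / real (Suc (max n m)) \<le> 1 / Suc m" by (simp add: field_simps)
    then show False using n[of i] i m by simp
  qed
qed

lemma limsup_greater:
  fixes f :: "nat \<Rightarrow> real"
  assumes "\<And>n. \<exists>i\<ge>n. a < f i" and "b < a"
  shows "ereal b < limsup (\<lambda>i. ereal (f i))"
proof (rule ccontr)
  assume "\<not> ereal b < limsup (\<lambda>i. ereal (f i))"
  then have "limsup (\<lambda>i. ereal (f i)) < ereal a" using assms(2) by (simp add: order_le_less_trans not_less)
  then have "\<forall>\<^sub>F i in sequentially. ereal (f i) < ereal a" by (rule Limsup_lessD)
  then obtain n where "\<And>i. n \<le> i \<Longrightarrow> f i < a" by (auto simp: eventually_sequentially)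
  then show False using assms(1)[of n] by fastforce
qed

text \<open>The pairs that at some time \<open>i \<ge> n\<close> are closer than \<open>1 / Suc n\<close> and at some time \<open>i \<ge> n\<close> are further
  apart than \<open>1 / Suc m\<close> form an open set \<open>R n\<close>.  It has full measure in the square of \<open>M\<close>, hence is
  dense in the square of the support, and Mycielski's theorem applies.\<close>

lemma (in label_measure) dense_scrambled_set:
  assumes compact: "compact (UNIV :: 'x set)" and T: "\<And>i. continuous_on UNIV (T i)"
    and near: "AE p in M \<Otimes>\<^sub>M M. \<forall>k. \<exists>\<^sub>F i in sequentially. map_prod (T i) (T i) p \<in> near k"
    and far: "AE p in M \<Otimes>\<^sub>M M. \<exists>\<^sub>F i in sequentially. map_prod (T i) (T i) p \<in> far m"
  obtains D where "dense_mycielski_subset D (measure_supp M)"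
    "\<And>x x' n. x \<in> D \<Longrightarrow> x' \<in> D \<Longrightarrow> x \<noteq> x' \<Longrightarrow>
       (\<exists>i\<ge>n. dist (T i x) (T i x') < 1 / Suc n) \<and> (\<exists>i\<ge>n. 1 / Suc m < dist (T i x) (T i x'))"
proof -
  define R where "R n = (\<Union>i\<in>{n..}. {(x, x'). dist (T i x) (T i x') < 1 / Suc n}) \<inter>
      (\<Union>i\<in>{n..}. {(x, x'). 1 / Suc m < dist (T i x) (T i x')})" for n
  have open_R: "open (R n)" for n
  proof -
    have cont: "continuous_on UNIV (\<lambda>p. dist (T i (fst p)) (T i (snd p)))" for i
      by (intro continuous_on_dist continuous_on_compose2[OF T] continuous_intros) auto
    show ?thesis unfolding R_def split_beta
      by (intro open_Int open_UN ballI open_Collect_less cont continuous_on_const)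
  qed
  have irrefl: "(x, x) \<notin> R n" for n x unfolding R_def by (auto simp: not_less)
  have AE_R: "AE p in M \<Otimes>\<^sub>M M. \<forall>n. p \<in> R n"
    using near far
  proof eventually_elim
    case (elim p)
    obtain x x' where p: "p = (x, x')" by (cases p)
    show ?case
    proof
      fix n
      obtain i where i: "n \<le> i" "map_prod (T i) (T i) p \<in> near n"
        using elim(1) by (auto simp: frequently_sequentially)
      then have "dist (T i x) (T i x') < 1 / Suc n" unfolding p using label_dist by (simp add: mem_near)
      moreover obtain j where j: "n \<le> j" "map_prod (T j) (T j) p \<in> far m"
        using elim(2) by (auto simp: frequently_sequentially)
      then have "1 / Suc m < dist (T j x) (T j x')" unfolding p by (auto simp: mem_far)
      ultimately show "p \<in> R n" using i j unfolding R_def p by blast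
    qed
  qed
  have dense: "\<exists>x\<in>A \<inter> measure_supp M. \<exists>x'\<in>B \<inter> measure_supp M. (x, x') \<in> R n"
    if AB: "open A" "open B" "A \<inter> measure_supp M \<noteq> {}" "B \<inter> measure_supp M \<noteq> {}" for n A B
  proof (rule ccontr)
    assume no: "\<not> ?thesis"
    have supp: "measure_supp M \<in> sets M" using closed_measure_supp sets_M by simp
    have pos: "0 < prob (U \<inter> measure_supp M)" if "open U" "U \<inter> measure_supp M \<noteq> {}" for U
    proof -
      have "0 < emeasure M U" using that unfolding measure_supp_def by auto
      also have "emeasure M U = emeasure M (U \<inter> measure_supp M)"
        by (rule emeasure_eq_AE) (use AE_measure_supp that(1) supp sets_M in \<open>auto elim: eventually_mono\<close>)
      finally show ?thesis by (simp add: emeasure_eq_measure)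
    qed
    let ?Q = "(A \<inter> measure_supp M) \<times> (B \<inter> measure_supp M)"
    have Q: "A \<inter> measure_supp M \<in> sets M" "B \<inter> measure_supp M \<in> sets M" using AB supp sets_M by auto
    have "AE p in M \<Otimes>\<^sub>M M. p \<notin> ?Q" using AE_R by eventually_elim (use no in blast)
    then have "square.prob ?Q = 0"
      using Q by (intro square.prob_eq_0[THEN iffD2]) auto
    then show False using pos[of A] pos[of B] AB prob_square_times[OF Q] by simp
  qed
  have compact_supp: "compact (measure_supp M)"
    using compact_Int_closed[OF compact closed_measure_supp] by simp
  show ?thesis
  proof (rule mycielski[of "measure_supp M" R, OF compact_supp open_R irrefl dense])
    fix D assume D: "dense_mycielski_subset D (measure_supp M)"
      "\<And>x x' n. x \<in> D \<Longrightarrow> x' \<in> D \<Longrightarrow> x \<noteq> x' \<Longrightarrow> (x, x') \<in> R n"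
    have "(\<exists>i\<ge>n. dist (T i x) (T i x') < 1 / Suc n) \<and> (\<exists>i\<ge>n. 1 / Suc m < dist (T i x) (T i x'))"
      if "x \<in> D" "x' \<in> D" "x \<noteq> x'" for x x' n
      using D(2)[OF that, of n] unfolding R_def by auto
    then show thesis using that[OF D(1)] by presburger
  qed
qed

section \<open>Returning to spread-out fibres\<close>

context relatively_mixing_extension
begin

text \<open>Convergence in \<open>L\<^sup>1\<close> gives almost everywhere convergence along a subsequence, and a diagonal argument
  makes one subsequence serve all pairs of cells, enumerated by \<open>A\<close> and \<open>B\<close>.  As the cells generate
  the Borel sets, the limit relation extends from cells to all test sets.\<close>

lemma AE_mixing_subsequence:
  assumes s: "inj s" "range s \<subseteq> carrier G"
  obtains r :: "nat \<Rightarrow> nat" where "strict_mono r"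
    "AE y in \<nu>. \<forall>k j. mixing_events (K y) (\<lambda>i. \<alpha> (s (r i)) -` cell k j)"
proof -
  define A where "A n = (case from_nat n :: nat \<times> nat \<times> nat \<times> nat of (k, j, l, q) \<Rightarrow> cell k j)" for n
  define B where "B n = (case from_nat n :: nat \<times> nat \<times> nat \<times> nat of (k, j, l, q) \<Rightarrow> cell l q)" for n
  have AB: "A n \<in> sets borel" "B n \<in> sets borel" for n
    unfolding A_def B_def using label_sets by (auto split: prod.split)
  have si: "s i \<in> carrier G" for i using s(2) by blast
  define P where "P n t \<longleftrightarrow> (AE y in \<nu>. (\<lambda>i. decorrelation (s (t i)) (A n) (B n) y) \<longlonglongrightarrow> 0)"
    for n :: nat and t :: "nat \<Rightarrow> nat"
  interpret subseqs P
  proof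
    fix n :: nat and t :: "nat \<Rightarrow> nat" assume t: "strict_mono t"
    have inj: "inj (s \<circ> t)" using inj_compose[OF s(1) strict_mono_imp_inj_on[OF t]] .
    have range: "range (s \<circ> t) \<subseteq> carrier G" using si by auto
    have "\<exists>r::nat\<Rightarrow>nat. strict_mono r \<and>
        (AE y in \<nu>. (\<lambda>i. decorrelation ((s \<circ> t) (r i)) (A n) (B n) y) \<longlonglongrightarrow> 0)"
    proof (rule tendsto_L1_AE_subseq)
      show "integrable \<nu> (decorrelation ((s \<circ> t) i) (A n) (B n))" for i
        using integrable_abs_cancel[OF integrable_abs_decorrelation[OF si AB] decorrelation_measurable[OF si AB]]
        by simp
      show "(\<lambda>i. \<integral>y. norm (decorrelation ((s \<circ> t) i) (A n) (B n) y) \<partial>\<nu>) \<longlonglongrightarrow> 0"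
        using decorrelation_tendsto_0[OF inj range AB] by simp
    qed
    then show "\<exists>r'. strict_mono r' \<and> P n (t \<circ> r')" unfolding P_def by simp
  qed
  have stable: "P n (t \<circ> r)" if "strict_mono r" "P n t" for r t n
    using that(2) unfolding P_def
    by eventually_elim (use LIMSEQ_subseq_LIMSEQ[OF _ that(1)] in \<open>auto simp: o_def\<close>)
  define q where "q = diagseq"
  have q_mono: "strict_mono q" unfolding q_def by (rule subseq_diagseq)
  have "P n (q \<circ> (+) (Suc n))" for n
    by (unfold q_def, rule diagseq_holds) (rule stable)
  then have "P n q" for n
    unfolding P_def
  proof (rule eventually_mono)
    fix y
    assume "(\<lambda>i. decorrelation (s ((q \<circ> (+) (Suc n)) i)) (A n) (B n) y) \<longlonglongrightarrow> 0"
    then show "(\<lambda>i. decorrelation (s (q i)) (A n) (B n) y) \<longlonglongrightarrow> 0"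
      using LIMSEQ_offset[of "\<lambda>i. decorrelation (s (q i)) (A n) (B n) y" "Suc n"] by (simp add: o_def add.commute)
  qed
  then have "AE y in \<nu>. \<forall>n. (\<lambda>i. decorrelation (s (q i)) (A n) (B n) y) \<longlonglongrightarrow> 0"
    by (simp add: P_def AE_all_countable)
  with AE_space have "AE y in \<nu>. \<forall>k j. mixing_events (K y) (\<lambda>i. \<alpha> (s (q i)) -` cell k j)"
  proof eventually_elim
    case (elim y)
    interpret label_measure c "K y" using label_measure_K elim(1) .
    have "mixing_events (K y) (\<lambda>i. \<alpha> (s (q i)) -` cell k j)" for k j
    proof (rule mixing_eventsI_generator[OF Int_stable_cells])
      show "range (\<lambda>(k, j). cell k j) \<subseteq> Pow (space (K y))" by (simp add: space_M)
      show "sets (K y) = sigma_sets (space (K y)) (range (\<lambda>(k, j). cell k j))"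
        unfolding sets_M space_M by (rule borel_eq_sigma_cells)
      show "\<alpha> (s (q i)) -` cell k j \<in> sets (K y)" for i
        using vimage_\<alpha>_sets[OF si label_sets] sets_M by simp
      fix W assume "W \<in> range (\<lambda>(k, j). cell k j)"
      then obtain l p where W: "W = cell l p" by auto
      have "(\<lambda>i. decorrelation (s (q i)) (cell k j) W y) \<longlonglongrightarrow> 0"
        using elim(2)[rule_format, of "to_nat (k, j, l, p)"] unfolding A_def B_def W by simp
      then show "(\<lambda>i. prob (W \<inter> \<alpha> (s (q i)) -` cell k j) - prob W * prob (\<alpha> (s (q i)) -` cell k j)) \<longlonglongrightarrow> 0"
        unfolding decorrelation_def .
    qed
    then show ?case by blast
  qed
  then show ?thesis using that q_mono by blast
qed

definition far_mass :: "nat \<Rightarrow> 'y \<Rightarrow> real" where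
  "far_mass m y = measure (fibre_square y) (far m)"

text \<open>The base points whose fibre measure gives two independent random points a quantitative chance of lying
  in far apart cells.\<close>

definition spread_base :: "nat \<Rightarrow> 'y set" where
  "spread_base m = {y \<in> space \<nu>. 1 / Suc m < far_mass m y}"

definition returning_base :: "(nat \<Rightarrow> 'g) \<Rightarrow> nat \<Rightarrow> 'y set" where
  "returning_base t m = {y \<in> space \<nu>. \<exists>\<^sub>F i in sequentially. \<beta> (t i) y \<in> spread_base m}"

lemma far_mass_measurable: "far_mass m \<in> borel_measurable \<nu>"
  unfolding far_mass_def using measure_square_measurable[OF far_sets[OF sets_\<mu>]] .

lemma spread_base_sets: "spread_base m \<in> sets \<nu>"
  unfolding spread_base_def using far_mass_measurable by measurable

lemma far_mass_le: "y \<in> space \<nu> \<Longrightarrow> far_mass m y \<le> 1 - diagonal_mass y"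
proof -
  assume "y \<in> space \<nu>"
  then interpret label_measure c "K y" by (rule label_measure_K)
  have "square.prob (far m) + square.prob Id = square.prob (far m \<union> Id)"
    by (rule square.finite_measure_Union[symmetric])
      (use far_sets[OF sets_M] Id_sets[OF sets_M] far_disjoint_Id in auto)
  also have "\<dots> \<le> 1" by simp
  finally show ?thesis unfolding far_mass_def diagonal_mass_def by simp
qed

text \<open>Both \<open>far m\<close> and the region above the threshold \<open>1 / Suc m\<close> grow with \<open>m\<close>.\<close>

lemma incseq_spread_base: "incseq spread_base"
proof (rule incseq_SucI)
  fix m
  show "spread_base m \<subseteq> spread_base (Suc m)"
  proof
    fix y assume y: "y \<in> spread_base m"
    then interpret label_measure c "K y" by (intro label_measure_K) (simp add: spread_base_def)
    have "far_mass m y \<le> far_mass (Suc m) y"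
      unfolding far_mass_def using incseq_far far_sets[OF sets_M]
      by (intro square.finite_measure_mono) (auto simp: incseq_Suc_iff)
    moreover have "1 / real (Suc (Suc m)) \<le> 1 / Suc m" by (simp add: field_simps)
    ultimately show "y \<in> spread_base (Suc m)" using y unfolding spread_base_def by auto
  qed
qed

lemma Union_spread_base: "(\<Union>m. spread_base m) = {y \<in> space \<nu>. diagonal_mass y < 1}"
proof (intro equalityI subsetI)
  fix y assume "y \<in> (\<Union>m. spread_base m)"
  then obtain m where "y \<in> space \<nu>" "1 / Suc m < far_mass m y" unfolding spread_base_def by auto
  moreover have "0 < 1 / real (Suc m)" by simp
  moreover have "far_mass m y \<le> 1 - diagonal_mass y" by (rule far_mass_le) fact
  ultimately have "diagonal_mass y < 1" by linarith
  then show "y \<in> {y \<in> space \<nu>. diagonal_mass y < 1}" using \<open>y \<in> space \<nu>\<close> by simp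
next
  fix y assume y: "y \<in> {y \<in> space \<nu>. diagonal_mass y < 1}"
  then interpret label_measure c "K y" by (intro label_measure_K) simp
  have "(\<lambda>m. far_mass m y - 1 / Suc m) \<longlonglongrightarrow> (1 - diagonal_mass y) - 0"
    unfolding far_mass_def diagonal_mass_def
    using LIMSEQ_inverse_real_of_nat by (intro tendsto_diff far_tendsto) (simp add: inverse_eq_divide)
  then have "\<forall>\<^sub>F m in sequentially. 0 < far_mass m y - 1 / Suc m"
    by (rule order_tendstoD) (use y in simp)
  then obtain m where "0 < far_mass m y - 1 / Suc m" by (auto dest: eventually_happens)
  then show "y \<in> (\<Union>m. spread_base m)" using y unfolding spread_base_def by auto
qed

lemma returning_base_eq:
  "returning_base t m = (\<Inter>n. \<Union>i\<in>{n..}. \<beta> (t i) -` spread_base m \<inter> space \<nu>)"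
  unfolding returning_base_def frequently_sequentially by fastforce

lemma vimage_\<beta>_sets: "g \<in> carrier G \<Longrightarrow> B \<in> sets \<nu> \<Longrightarrow> \<beta> g -` B \<inter> space \<nu> \<in> sets \<nu>"
  using \<beta>_measurable by (rule measurable_sets)

lemma returning_base_sets: "range t \<subseteq> carrier G \<Longrightarrow> returning_base t m \<in> sets \<nu>"
  unfolding returning_base_eq
  by (intro sets.countable_INT image_subsetI sets.countable_UN' vimage_\<beta>_sets spread_base_sets) auto

text \<open>Fatou's lemma for sets: each preimage under \<open>\<beta> (t i)\<close> has the measure of \<open>spread_base m\<close>, hence so
  has, at least, their limit superior.  This bound does not depend on \<open>t\<close>, which is what makes a
  constant \<open>\<delta>\<close> independent of the sequence possible.\<close>

lemma measure_spread_base_le: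
  assumes t: "range t \<subseteq> carrier G"
  shows "base.prob (spread_base m) \<le> base.prob (returning_base t m)"
proof -
  let ?U = "\<lambda>n. \<Union>i\<in>{n..}. \<beta> (t i) -` spread_base m \<inter> space \<nu>"
  have ti: "t i \<in> carrier G" for i using t by blast
  have U: "?U n \<in> sets \<nu>" for n
    by (intro sets.countable_UN' image_subsetI vimage_\<beta>_sets spread_base_sets ti) auto
  have "base.prob (spread_base m) \<le> base.prob (?U n)" for n
  proof -
    have "base.prob (spread_base m) = measure (distr \<nu> \<nu> (\<beta> (t n))) (spread_base m)"
      unfolding \<beta>_distr[OF ti] ..
    also have "\<dots> = base.prob (\<beta> (t n) -` spread_base m \<inter> space \<nu>)"
      by (rule measure_distr[OF \<beta>_measurable[OF ti] spread_base_sets])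
    also have "\<dots> \<le> base.prob (?U n)" by (rule base.finite_measure_mono[OF _ U]) auto
    finally show ?thesis .
  qed
  moreover have "(\<lambda>n. base.prob (?U n)) \<longlonglongrightarrow> base.prob (\<Inter>n. ?U n)"
  proof (rule base.finite_Lim_measure_decseq)
    show "range ?U \<subseteq> sets \<nu>" using U by blast
    show "decseq ?U" unfolding decseq_def by (intro allI impI UN_mono) auto
  qed
  ultimately show ?thesis unfolding returning_base_eq by (intro LIMSEQ_le_const) auto
qed

lemma AE_far_mass_equivariant:
  assumes "g \<in> carrier G"
  shows "AE y in \<nu>. far_mass m (\<beta> g y) = measure (fibre_square y) (map_prod (\<alpha> g) (\<alpha> g) -` far m)"
  unfolding far_mass_def far_def by (rule measure_rectangles_equivariant[OF assms finite_far_labels])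

text \<open>The preimage of \<open>far m\<close> under a diagonal map avoids the diagonal, so a positive mass of it at some
  time shows that \<open>K y\<close> itself is not Dirac.\<close>

lemma AE_returning_base_diagonal_mass:
  assumes t: "range t \<subseteq> carrier G"
  shows "AE y in \<nu>. y \<in> returning_base t m \<longrightarrow> diagonal_mass y < 1"
proof -
  have ti: "t i \<in> carrier G" for i using t by blast
  have "AE y in \<nu>. \<forall>i. far_mass m (\<beta> (t i) y) = measure (fibre_square y) (map_prod (\<alpha> (t i)) (\<alpha> (t i)) -` far m)"
    unfolding AE_all_countable by (intro allI AE_far_mass_equivariant ti)
  with AE_space show ?thesis
  proof eventually_elim
    case (elim y)
    interpret label_measure c "K y" using label_measure_K elim(1) .
    show ?case
    proof
      assume "y \<in> returning_base t m"
      then obtain i where i: "1 / Suc m < far_mass m (\<beta> (t i) y)"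
        unfolding returning_base_def spread_base_def by (auto dest: frequently_ex)
      let ?V = "map_prod (\<alpha> (t i)) (\<alpha> (t i)) -` far m"
      have "\<alpha> (t i) -` cell m j \<in> sets (K y)" for j using vimage_\<alpha>_sets[OF ti label_sets] sets_M by simp
      then have V: "?V \<in> sets (K y \<Otimes>\<^sub>M K y)"
        unfolding far_def vimage_cell_rectangles by (intro sets.finite_UN finite_far_labels pair_measureI)
      have "?V \<inter> Id = {}" using far_disjoint_Id[of m] by auto
      then have "square.prob ?V + square.prob Id = square.prob (?V \<union> Id)"
        by (intro square.finite_measure_Union[symmetric] V Id_sets[OF sets_M])
      also have "\<dots> \<le> 1" by simp
      finally show "diagonal_mass y < 1" using i elim(2) unfolding diagonal_mass_def
        by (smt (verit) divide_nonneg_nonneg of_nat_0_le_iff)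
    qed
  qed
qed

text \<open>The bound of \<open>measure_spread_base_le\<close> for all \<open>m\<close> shows that the union of the returning sets is as
  large as the set of \<open>y\<close> with non-Dirac fibre measure, in which it is contained up to a null set.\<close>

lemma AE_returning_base:
  assumes t: "range t \<subseteq> carrier G"
  shows "AE y in \<nu>. diagonal_mass y < 1 \<longrightarrow> (\<exists>m. y \<in> returning_base t m)"
proof -
  let ?D = "{y \<in> space \<nu>. diagonal_mass y < 1}" and ?R = "\<Union>m. returning_base t m"
  have D: "?D \<in> sets \<nu>" using diagonal_mass_measurable by measurable
  have R: "?R \<in> sets \<nu>" using returning_base_sets[OF t] by auto
  have "(\<lambda>m. base.prob (spread_base m)) \<longlonglongrightarrow> base.prob ?D"
    unfolding Union_spread_base[symmetric]
    by (rule base.finite_Lim_measure_incseq) (use spread_base_sets incseq_spread_base in auto)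
  moreover have "base.prob (spread_base m) \<le> base.prob ?R" for m
    by (rule order_trans[OF measure_spread_base_le[OF t] base.finite_measure_mono[OF _ R]]) blast
  ultimately have "base.prob ?D \<le> base.prob ?R" by (intro LIMSEQ_le_const2) auto
  also have "base.prob ?R = base.prob (?D \<inter> ?R)"
  proof (rule measure_eq_AE)
    have "AE y in \<nu>. \<forall>m. y \<in> returning_base t m \<longrightarrow> diagonal_mass y < 1"
      unfolding AE_all_countable by (intro allI AE_returning_base_diagonal_mass t)
    with AE_space show "AE y in \<nu>. (y \<in> ?R) = (y \<in> ?D \<inter> ?R)" by eventually_elim auto
  qed (use D R in auto)
  finally have "base.prob (?D - ?R) = 0"
    using base.finite_measure_Diff'[OF D R] measure_nonneg[of \<nu> "?D - ?R"] by linarith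
  then have "?D - ?R \<in> null_sets \<nu>" using D R by (intro null_setsI) (auto simp: base.emeasure_eq_measure)
  from AE_not_in[OF this] AE_space show ?thesis by eventually_elim auto
qed

text \<open>For almost every \<open>y\<close> the preimages of \<open>near k\<close> and of \<open>far m\<close> along the subsequence are mixing
  sequences of events for the square of \<open>K y\<close>.  Those of \<open>near k\<close> have mass at least the inverse of
  the number of cells; for \<open>y\<close> in the returning set, those of \<open>far m\<close> have mass above
  \<open>1 / Suc m\<close> infinitely often, by equivariance of the fibre measures.  So almost every pair visits both kinds
  of sets infinitely often.\<close>

lemma AE_scrambled_on_returning_base:
  assumes compact: "compact (UNIV :: 'x set)"
    and cont: "\<And>g. g \<in> carrier G \<Longrightarrow> continuous_on UNIV (\<alpha> g)"
    and s: "inj s" "range s \<subseteq> carrier G"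
  obtains r :: "nat \<Rightarrow> nat" where "AE y in \<nu>. \<forall>m. y \<in> returning_base (s \<circ> r) m \<longrightarrow>
      (\<exists>D. dense_mycielski_subset D (measure_supp (K y)) \<and> scrambled_along \<alpha> s (1 / real (m + 2)) D)"
proof -
  obtain r :: "nat \<Rightarrow> nat" where r: "strict_mono r"
    and mix: "AE y in \<nu>. \<forall>k j. mixing_events (K y) (\<lambda>i. \<alpha> (s (r i)) -` cell k j)"
    by (rule AE_mixing_subsequence[OF s])
  have si: "s i \<in> carrier G" for i using s(2) by blast
  have "AE y in \<nu>. \<forall>m i. far_mass m (\<beta> (s (r i)) y) =
      measure (fibre_square y) (map_prod (\<alpha> (s (r i))) (\<alpha> (s (r i))) -` far m)"
    unfolding AE_all_countable by (intro allI AE_far_mass_equivariant si)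
  with mix AE_space have "AE y in \<nu>. \<forall>m. y \<in> returning_base (s \<circ> r) m \<longrightarrow>
      (\<exists>D. dense_mycielski_subset D (measure_supp (K y)) \<and> scrambled_along \<alpha> s (1 / real (m + 2)) D)"
  proof eventually_elim
    case (elim y)
    interpret label_measure c "K y" using label_measure_K elim(2) .
    let ?T = "\<lambda>i. \<alpha> (s (r i))"
    have T: "?T i -` cell k j \<in> sets (K y)" for i k j using vimage_\<alpha>_sets[OF si label_sets] sets_M by simp
    have near: "AE p in K y \<Otimes>\<^sub>M K y. \<forall>k. \<exists>\<^sub>F i in sequentially. map_prod (?T i) (?T i) p \<in> near k"
      unfolding AE_all_countable
    proof
      fix k
      have "mixing_events (K y \<Otimes>\<^sub>M K y) (\<lambda>i. map_prod (?T i) (?T i) -` near k)"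
        unfolding near_def using elim(1) finite_labels by (intro mixing_vimage_cell_rectangles) auto
      moreover have "0 < 1 / real (card (range (c k)))" using finite_labels by (simp add: card_gt_0_iff)
      moreover have "\<exists>\<^sub>F i in sequentially. 1 / card (range (c k)) \<le> square.prob (map_prod (?T i) (?T i) -` near k)"
        using prob_near_vimage_lower_bound[OF T] by (intro eventually_frequently always_eventually) auto
      ultimately have "AE p in K y \<Otimes>\<^sub>M K y. \<exists>\<^sub>F i in sequentially. p \<in> map_prod (?T i) (?T i) -` near k"
        by (rule square.mixing_events_infinitely_often)
      then show "AE p in K y \<Otimes>\<^sub>M K y. \<exists>\<^sub>F i in sequentially. map_prod (?T i) (?T i) p \<in> near k" by simp
    qed
    show ?case
    proof (intro allI impI)
      fix m assume y: "y \<in> returning_base (s \<circ> r) m"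
      have "mixing_events (K y \<Otimes>\<^sub>M K y) (\<lambda>i. map_prod (?T i) (?T i) -` far m)"
        unfolding far_def using elim(1) finite_far_labels by (intro mixing_vimage_cell_rectangles) auto
      moreover have "0 < 1 / real (Suc m)" by simp
      moreover have "\<exists>\<^sub>F i in sequentially. 1 / Suc m \<le> square.prob (map_prod (?T i) (?T i) -` far m)"
      proof -
        have "\<exists>\<^sub>F i in sequentially. \<beta> (s (r i)) y \<in> spread_base m" using y unfolding returning_base_def by simp
        then show ?thesis by (rule frequently_elim1) (use elim(3) in \<open>simp add: spread_base_def\<close>)
      qed
      ultimately have "AE p in K y \<Otimes>\<^sub>M K y. \<exists>\<^sub>F i in sequentially. p \<in> map_prod (?T i) (?T i) -` far m"
        by (rule square.mixing_events_infinitely_often)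
      then have far: "AE p in K y \<Otimes>\<^sub>M K y. \<exists>\<^sub>F i in sequentially. map_prod (?T i) (?T i) p \<in> far m" by simp
      obtain D where D: "dense_mycielski_subset D (measure_supp (K y))"
        "\<And>x x' n. x \<in> D \<Longrightarrow> x' \<in> D \<Longrightarrow> x \<noteq> x' \<Longrightarrow>
           (\<exists>i\<ge>n. dist (?T i x) (?T i x') < 1 / Suc n) \<and> (\<exists>i\<ge>n. 1 / Suc m < dist (?T i x) (?T i x'))"
        using dense_scrambled_set[OF compact cont[OF si] near far] by blast
      \<comment> \<open>The limit superior is at least \<open>1 / Suc m\<close>; \<open>m + 2\<close> instead of \<open>m + 1\<close> makes the inequality
        strict.\<close>
      have "scrambled_along \<alpha> s (1 / real (m + 2)) D"
        unfolding scrambled_along_def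
      proof (intro ballI impI conjI)
        fix x x' assume x: "x \<in> D" "x' \<in> D" "x \<noteq> x'"
        have le: "n \<le> r i" if "n \<le> i" for n i using that seq_suble[OF r, of i] by simp
        show "liminf (\<lambda>i. ereal (dist (\<alpha> (s i) x) (\<alpha> (s i) x'))) = 0"
        proof (rule liminf_dist_eq_0)
          show "\<exists>i\<ge>n. dist (\<alpha> (s i) x) (\<alpha> (s i) x') < 1 / Suc n" for n
            using D(2)[OF x, of n] le by blast
        qed simp
        show "ereal (1 / real (m + 2)) < limsup (\<lambda>i. ereal (dist (\<alpha> (s i) x) (\<alpha> (s i) x')))"
        proof (rule limsup_greater)
          show "\<exists>i\<ge>n. 1 / Suc m < dist (\<alpha> (s i) x) (\<alpha> (s i) x')" for n
            using D(2)[OF x, of n] le by blast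
        qed (simp add: field_simps)
      qed
      then show "\<exists>D. dense_mycielski_subset D (measure_supp (K y)) \<and> scrambled_along \<alpha> s (1 / real (m + 2)) D"
        using D(1) by blast
    qed
  qed
  then show ?thesis by (rule that)
qed

end

section \<open>Scrambled sets in the fibres of a relatively mixing extension\<close>

theorem theorem1p3:
  fixes G :: "('g, 'r) monoid_scheme"
    and \<alpha> :: "'g \<Rightarrow> 'x \<Rightarrow> 'x :: metric_space"
    and \<mu> :: "'x measure"
    and \<beta> :: "'g \<Rightarrow> 'y \<Rightarrow> 'y"
    and \<nu> :: "'y measure"
    and \<pi> :: "'x \<Rightarrow> 'y"
    and \<mu>\<^sub>Y :: "'y \<Rightarrow> 'x measure"
  assumes "group G" and "countable (carrier G)" and "infinite (carrier G)"
    and "compact (UNIV :: 'x set)"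
    and "sets \<mu> = sets borel" and "prob_space \<mu>"
    and "mp_action G \<mu> \<alpha>"
    and "\<And>g. g \<in> carrier G \<Longrightarrow> continuous_on UNIV (\<alpha> g)"
    and "standard_prob_space \<nu>" and "mp_action G \<nu> \<beta>"
    and "factor_map G \<mu> \<alpha> \<nu> \<beta> \<pi>"
    and "disintegration \<mu> \<nu> \<pi> \<mu>\<^sub>Y"
    and "relatively_mixing G \<mu> \<alpha> \<nu> \<mu>\<^sub>Y"
    and "\<not> system_isomorphism G \<mu> \<alpha> \<nu> \<beta> \<pi>"
  shows "nonatomic_fibres \<nu> \<mu>\<^sub>Y \<in> sets \<nu> \<and> emeasure \<nu> (nonatomic_fibres \<nu> \<mu>\<^sub>Y) > 0 \<and>
    (\<forall>s :: nat \<Rightarrow> 'g. inj s \<longrightarrow> range s \<subseteq> carrier G \<longrightarrow>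
       (AE y in \<nu>. y \<in> nonatomic_fibres \<nu> \<mu>\<^sub>Y \<longrightarrow>
          (\<exists>\<delta>>0. \<exists>M. dense_mycielski_subset M (measure_supp (\<mu>\<^sub>Y y)) \<and>
             scrambled_along \<alpha> s \<delta> M))) \<and>
    (\<exists>\<delta>>0. \<forall>s :: nat \<Rightarrow> 'g. inj s \<longrightarrow> range s \<subseteq> carrier G \<longrightarrow>
       (\<exists>Y'\<in>sets \<nu>. Y' \<subseteq> nonatomic_fibres \<nu> \<mu>\<^sub>Y \<and> emeasure \<nu> Y' > 0 \<and>
          (\<forall>y\<in>Y'. \<exists>M. dense_mycielski_subset M (measure_supp (\<mu>\<^sub>Y y)) \<and>
             scrambled_along \<alpha> s \<delta> M)))"
proof -
  obtain c :: "nat \<Rightarrow> 'x \<Rightarrow> nat" where "refining_labels c"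
    using refining_labels_exist[OF assms(4)] by blast
  then interpret relatively_mixing_extension c G \<alpha> \<mu> \<beta> \<nu> \<pi> \<mu>\<^sub>Y
    using assms by (intro relatively_mixing_extension.intro relatively_mixing_extension_axioms.intro)
      (auto simp: standard_prob_space_def)
  let ?Y = "nonatomic_fibres \<nu> \<mu>\<^sub>Y"
  note scrambled = AE_scrambled_on_returning_base[OF assms(4) assms(8)]
  have pos: "0 < emeasure \<nu> ?Y" by (rule nonatomic_fibres_pos[OF assms(14)])
  have fibrewise: "AE y in \<nu>. y \<in> ?Y \<longrightarrow>
      (\<exists>\<delta>>0. \<exists>M. dense_mycielski_subset M (measure_supp (\<mu>\<^sub>Y y)) \<and> scrambled_along \<alpha> s \<delta> M)"
    if s: "inj s" "range s \<subseteq> carrier G" for s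
  proof -
    obtain r :: "nat \<Rightarrow> nat" where r: "AE y in \<nu>. \<forall>m. y \<in> returning_base (s \<circ> r) m \<longrightarrow>
      (\<exists>D. dense_mycielski_subset D (measure_supp (\<mu>\<^sub>Y y)) \<and> scrambled_along \<alpha> s (1 / real (m + 2)) D)"
      by (rule scrambled[OF _ s])
    have "range (s \<circ> r) \<subseteq> carrier G" using s(2) by auto
    from r AE_returning_base[OF this] show ?thesis
    proof eventually_elim
      case (elim y)
      show ?case
      proof
        assume "y \<in> ?Y"
        then have "diagonal_mass y < 1" unfolding nonatomic_fibres_eq by simp
        then obtain m where "y \<in> returning_base (s \<circ> r) m" using elim(2) by blast
        with elim(1) have "\<exists>D. dense_mycielski_subset D (measure_supp (\<mu>\<^sub>Y y)) \<and> scrambled_along \<alpha> s (1 / real (m + 2)) D"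
          by simp
        moreover have "0 < 1 / real (m + 2)" by simp
        ultimately show "\<exists>\<delta>>0. \<exists>M. dense_mycielski_subset M (measure_supp (\<mu>\<^sub>Y y)) \<and> scrambled_along \<alpha> s \<delta> M"
          by (intro exI[of _ "1 / real (m + 2)"] conjI)
      qed
    qed
  qed
  obtain m where m: "0 < base.prob (spread_base m)"
  proof -
    have "\<exists>m. emeasure \<nu> (spread_base m) \<noteq> 0"
    proof (rule ccontr)
      assume "\<not> ?thesis"
      then have "(\<Union>m. spread_base m) \<in> null_sets \<nu>" using spread_base_sets by (intro null_sets_UN) auto
      moreover have "?Y \<subseteq> (\<Union>m. spread_base m)" unfolding Union_spread_base nonatomic_fibres_eq by auto
      ultimately have "?Y \<in> null_sets \<nu>" using nonatomic_fibres_sets null_sets_subset by blast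
      then show False using pos by auto
    qed
    then show ?thesis using that by (auto simp: base.emeasure_eq_measure zero_less_measure_iff)
  qed
  have uniform: "\<exists>Y'\<in>sets \<nu>. Y' \<subseteq> ?Y \<and> emeasure \<nu> Y' > 0 \<and>
      (\<forall>y\<in>Y'. \<exists>M. dense_mycielski_subset M (measure_supp (\<mu>\<^sub>Y y)) \<and> scrambled_along \<alpha> s (1 / real (m + 2)) M)"
    if s: "inj s" "range s \<subseteq> carrier G" for s
  proof -
    obtain r :: "nat \<Rightarrow> nat" where r: "AE y in \<nu>. \<forall>m. y \<in> returning_base (s \<circ> r) m \<longrightarrow>
      (\<exists>D. dense_mycielski_subset D (measure_supp (\<mu>\<^sub>Y y)) \<and> scrambled_along \<alpha> s (1 / real (m + 2)) D)"
      by (rule scrambled[OF _ s])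
    have sr: "range (s \<circ> r) \<subseteq> carrier G" using s(2) by auto
    let ?R = "returning_base (s \<circ> r) m"
    from r obtain N where N: "{y \<in> space \<nu>. \<not> (\<forall>m. y \<in> returning_base (s \<circ> r) m \<longrightarrow>
      (\<exists>D. dense_mycielski_subset D (measure_supp (\<mu>\<^sub>Y y)) \<and> scrambled_along \<alpha> s (1 / real (m + 2)) D))} \<subseteq> N"
      "emeasure \<nu> N = 0" "N \<in> sets \<nu>" by (rule AE_E)
    let ?Y' = "?R \<inter> ?Y - N"
    have sets: "?Y' \<in> sets \<nu>" using returning_base_sets[OF sr] nonatomic_fibres_sets N(3) by blast
    have "AE y in \<nu>. y \<notin> N" using N by (intro AE_not_in) auto
    with AE_returning_base_diagonal_mass[OF sr, of m] diagonal_mass_zero_one AE_space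
    have "AE y in \<nu>. (y \<in> ?R) = (y \<in> ?Y')"
      unfolding nonatomic_fibres_eq by eventually_elim auto
    then have "base.prob ?R = base.prob ?Y'"
      by (rule measure_eq_AE) (use returning_base_sets[OF sr] sets in auto)
    then have "0 < emeasure \<nu> ?Y'" using m measure_spread_base_le[OF sr, of m] by (simp add: base.emeasure_eq_measure)
    moreover have "\<exists>M. dense_mycielski_subset M (measure_supp (\<mu>\<^sub>Y y)) \<and> scrambled_along \<alpha> s (1 / real (m + 2)) M"
      if "y \<in> ?Y'" for y
      using that N(1) unfolding nonatomic_fibres_eq by blast
    ultimately show ?thesis using sets by (intro bexI[of _ ?Y']) auto
  qed
  have "0 < 1 / real (m + 2)" by simp
  with uniform have "\<exists>\<delta>>0. \<forall>s :: nat \<Rightarrow> 'g. inj s \<longrightarrow> range s \<subseteq> carrier G \<longrightarrow>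
       (\<exists>Y'\<in>sets \<nu>. Y' \<subseteq> ?Y \<and> emeasure \<nu> Y' > 0 \<and>
          (\<forall>y\<in>Y'. \<exists>M. dense_mycielski_subset M (measure_supp (\<mu>\<^sub>Y y)) \<and> scrambled_along \<alpha> s \<delta> M))"
    by blast
  with nonatomic_fibres_sets pos fibrewise show ?thesis by blast
qed

end
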